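(* The statement "every $\delta$-Cauchy sequence has a limit" (completeness of $(\mathcal{S},\delta)$) is $\omega$-equivalent to $\mathrm{DOM}$; that is, for every Turing ideal $\mathcal{M}\subseteq\mathcal{P}(\omega)$, every $\delta$-Cauchy sequence $A_0,A_1,\ldots$ with $\bigoplus_i A_i\in\mathcal{M}$ has a limit in $\mathcal{M}$ if and only if for every $X\in\mathcal{M}$ there is a function $f\in\mathcal{M}$ that dominates every $X$-computable function.
   Context: For $X\subseteq\omega$, $\rho_n(X)=|X\cap[0,n)|/n$ and $\delta(X,Y)=\limsup_n\rho_n(X\bigtriangleup Y)$. A sequence $A_0,A_1,\ldots$ is $\delta$-Cauchy if for every $k$ there is $m$ with $\delta(A_m,A_n)\le 2^{-k}$ for all $n>m$; a set $A$ is a limit of it if for every $k$ there is $m$ with $\delta(A_n,A)\le 2^{-k}$ for all $n>m$. A Turing ideal is a nonempty subset of $\mathcal{P}(\omega)$ closed downward under $\le_T$ and under finite joins (these are exactly the $\omega$-models of $\mathrm{RCA}_0$, and two statements are $\omega$-equivalent if they hold in the same such models). $f$ dominates $g$ if $f(n)\ge g(n)$ for all sufficiently large $n$. DOM is the principle: for every $X$ there is a function dominating all $X$-computable functions. *)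

theory Defs
  imports "HOL-Library.Nat_Bijection" "HOL-Library.Extended_Real"
    "HOL-Library.Liminf_Limsup" "HOL-Library.Indicator_Function"
begin

section \<open>Relative computability\<close>

text \<open>
  Kleene's partial recursive functions relative to an oracle, in the unary presentation: several
  arguments are packed into one by the Cantor pairing function \<^const>\<open>prod_encode\<close>, and
  \<^const>\<open>None\<close> means that the computation diverges.
\<close>

primrec prim_rec :: "(nat \<rightharpoonup> nat) \<Rightarrow> (nat \<rightharpoonup> nat) \<Rightarrow> nat \<Rightarrow> nat \<Rightarrow> nat option" where
  "prim_rec f g a 0 = f a"
| "prim_rec f g a (Suc n) =
     Option.bind (prim_rec f g a n) (\<lambda>y. g (prod_encode (a, prod_encode (n, y))))"

text \<open>
  Unbounded search: the value at \<open>a\<close> is the least zero of \<open>f\<close> in its second argument, provided that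
  \<open>f\<close> is defined at all smaller arguments.
\<close>

definition minimize :: "(nat \<rightharpoonup> nat) \<Rightarrow> (nat \<rightharpoonup> nat)" where
  "minimize f a =
     (if \<exists>n. f (prod_encode (a, n)) = Some 0 \<and> (\<forall>i<n. f (prod_encode (a, i)) \<noteq> None)
      then Some (LEAST n. f (prod_encode (a, n)) = Some 0) else None)"

inductive partial_recursive_in :: "(nat \<Rightarrow> nat) \<Rightarrow> (nat \<rightharpoonup> nat) \<Rightarrow> bool" for h :: "nat \<Rightarrow> nat" where
  zero: "partial_recursive_in h (\<lambda>_. Some 0)"
| succ: "partial_recursive_in h (\<lambda>n. Some (Suc n))"
| left: "partial_recursive_in h (\<lambda>n. Some (fst (prod_decode n)))"
| right: "partial_recursive_in h (\<lambda>n. Some (snd (prod_decode n)))"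
| query: "partial_recursive_in h (\<lambda>n. Some (h n))"
| pair: "partial_recursive_in h f \<Longrightarrow> partial_recursive_in h g \<Longrightarrow>
    partial_recursive_in h
      (\<lambda>n. Option.bind (f n) (\<lambda>x. Option.bind (g n) (\<lambda>y. Some (prod_encode (x, y)))))"
| comp: "partial_recursive_in h f \<Longrightarrow> partial_recursive_in h g \<Longrightarrow>
    partial_recursive_in h (\<lambda>n. Option.bind (g n) f)"
| prec: "partial_recursive_in h f \<Longrightarrow> partial_recursive_in h g \<Longrightarrow>
    partial_recursive_in h (\<lambda>n. prim_rec f g (fst (prod_decode n)) (snd (prod_decode n)))"
| mini: "partial_recursive_in h f \<Longrightarrow> partial_recursive_in h (minimize f)"

definition computable_in :: "nat set \<Rightarrow> (nat \<Rightarrow> nat) \<Rightarrow> bool" where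
  "computable_in X f \<longleftrightarrow> partial_recursive_in (indicator X) (\<lambda>n. Some (f n))"

definition turing_le :: "nat set \<Rightarrow> nat set \<Rightarrow> bool"  (infix \<open>\<le>\<^sub>T\<close> 50) where
  "A \<le>\<^sub>T B \<longleftrightarrow> computable_in B (indicator A)"

section \<open>Turing ideals\<close>

text \<open>\<^const>\<open>sum_encode\<close> sends the left copy of \<open>n\<close> to \<open>2 * n\<close> and the right copy to \<open>2 * n + 1\<close>.\<close>

definition turing_join :: "nat set \<Rightarrow> nat set \<Rightarrow> nat set" where
  "turing_join A B = sum_encode ` (A <+> B)"

definition infinite_join :: "(nat \<Rightarrow> nat set) \<Rightarrow> nat set" where
  "infinite_join A = {prod_encode (i, n) | i n. n \<in> A i}"

definition turing_ideal :: "nat set set \<Rightarrow> bool" where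
  "turing_ideal \<M> \<longleftrightarrow> \<M> \<noteq> {} \<and>
     (\<forall>A B. A \<le>\<^sub>T B \<and> B \<in> \<M> \<longrightarrow> A \<in> \<M>) \<and>
     (\<forall>A\<in>\<M>. \<forall>B\<in>\<M>. turing_join A B \<in> \<M>)"

text \<open>A function belongs to an ideal when its graph, coded as a set of numbers, does.\<close>

definition graph_of :: "(nat \<Rightarrow> nat) \<Rightarrow> nat set" where
  "graph_of f = {prod_encode (n, f n) | n. True}"

definition omega_equivalent :: "(nat set set \<Rightarrow> bool) \<Rightarrow> (nat set set \<Rightarrow> bool) \<Rightarrow> bool" where
  "omega_equivalent P Q \<longleftrightarrow> (\<forall>\<M>. turing_ideal \<M> \<longrightarrow> (P \<M> \<longleftrightarrow> Q \<M>))"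

section \<open>The density pseudometric\<close>

definition rho :: "nat \<Rightarrow> nat set \<Rightarrow> real" where
  "rho n X = real (card (X \<inter> {0..<n})) / real n"

definition delta :: "nat set \<Rightarrow> nat set \<Rightarrow> ereal" where
  "delta X Y = limsup (\<lambda>n. ereal (rho n (sym_diff X Y)))"

definition delta_cauchy :: "(nat \<Rightarrow> nat set) \<Rightarrow> bool" where
  "delta_cauchy A \<longleftrightarrow> (\<forall>k::nat. \<exists>m. \<forall>n>m. delta (A m) (A n) \<le> ereal (1 / 2 ^ k))"

definition delta_limit :: "(nat \<Rightarrow> nat set) \<Rightarrow> nat set \<Rightarrow> bool" where
  "delta_limit A L \<longleftrightarrow> (\<forall>k::nat. \<exists>m. \<forall>n>m. delta (A n) L \<le> ereal (1 / 2 ^ k))"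

section \<open>The two principles, interpreted in an ideal\<close>

definition delta_complete :: "nat set set \<Rightarrow> bool" where
  "delta_complete \<M> \<longleftrightarrow>
     (\<forall>A. delta_cauchy A \<and> infinite_join A \<in> \<M> \<longrightarrow> (\<exists>L\<in>\<M>. delta_limit A L))"

definition dominates :: "(nat \<Rightarrow> nat) \<Rightarrow> (nat \<Rightarrow> nat) \<Rightarrow> bool" where
  "dominates f g \<longleftrightarrow> (\<forall>\<^sub>F n in sequentially. f n \<ge> g n)"

definition DOM :: "nat set set \<Rightarrow> bool" where
  "DOM \<M> \<longleftrightarrow>
     (\<forall>X\<in>\<M>. \<exists>f. graph_of f \<in> \<M> \<and> (\<forall>g. computable_in X g \<longrightarrow> dominates f g))"

end

(*
  Completeness implies domination. Let A_i contain x, with 2-adic valuation e, when the e-th partial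
  X-computable function is seen to converge on 0, ..., i within x steps. On the numbers of valuation
  e, A_i is almost everything if that function is total, and empty for all large i otherwise; so the
  sequence is Cauchy, and the density of a limit L among these numbers guesses in the limit whether
  the function is total. To compute f(n), wait for each e <= n until the e-th function has converged
  on n or L guesses that it is partial: the resulting f dominates every total one.

  Domination implies completeness. A function dominating all X-computable functions bounds the search
  for a counterexample to an eventual property whenever counterexamples occur infinitely often. So
  one application of DOM decides in the limit whether A_m and A_n are eventually 2^-k-close, and a
  second one decides this simultaneously for all n > m. Hence a modulus m_k of the Cauchy sequence is
  computable in the limit. On the p-th initial segment, follow the guess for m_(i+1) with i maximal
  such that the guesses for m_1, ..., m_(i+1) look coherent there.
*)
theory Submission
  imports Defs
begin

section \<open>Total functions and predicates computable in an oracle\<close>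

definition decidable_in :: "nat set \<Rightarrow> (nat \<Rightarrow> bool) \<Rightarrow> bool" where
  "decidable_in X P \<longleftrightarrow> computable_in X (\<lambda>n. of_bool (P n))"

lemma computable_in_compose:
  assumes "computable_in X f" "computable_in X g"
  shows "computable_in X (\<lambda>n. f (g n))"
  using partial_recursive_in.comp[OF assms[unfolded computable_in_def]]
  by (simp add: computable_in_def)

text \<open>The identity is not among the initial functions; it arises by pairing the two
  projections of the argument again.\<close>

lemma computable_in_id: "computable_in X (\<lambda>n. n)"
proof -
  have "partial_recursive_in (indicator X) (\<lambda>n. Option.bind (Some (fst (prod_decode n))) (\<lambda>x.
      Option.bind (Some (snd (prod_decode n))) (\<lambda>y. Some (prod_encode (x, y)))))"
    by (intro partial_recursive_in.intros)
  then show ?thesis by (simp add: computable_in_def)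
qed

lemma computable_in_Suc:
  "computable_in X f \<Longrightarrow> computable_in X (\<lambda>n. Suc (f n))"
  by (rule computable_in_compose[of X Suc])
    (auto simp: computable_in_def intro: partial_recursive_in.succ)

lemma computable_in_const: "computable_in X (\<lambda>_. k)"
proof (induction k)
  case 0
  show ?case by (simp add: computable_in_def partial_recursive_in.zero)
qed (rule computable_in_Suc)

lemma computable_in_fst:
  "computable_in X f \<Longrightarrow> computable_in X (\<lambda>n. fst (prod_decode (f n)))"
  by (rule computable_in_compose[of X "\<lambda>n. fst (prod_decode n)"])
    (auto simp: computable_in_def intro: partial_recursive_in.left)

lemma computable_in_snd:
  "computable_in X f \<Longrightarrow> computable_in X (\<lambda>n. snd (prod_decode (f n)))"
  by (rule computable_in_compose[of X "\<lambda>n. snd (prod_decode n)"])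
    (auto simp: computable_in_def intro: partial_recursive_in.right)

lemma computable_in_pair:
  assumes "computable_in X f" "computable_in X g"
  shows "computable_in X (\<lambda>n. prod_encode (f n, g n))"
  using partial_recursive_in.pair[OF assms[unfolded computable_in_def]]
  by (simp add: computable_in_def)

lemma decidable_in_oracle:
  assumes "computable_in X f"
  shows "decidable_in X (\<lambda>n. f n \<in> X)"
proof -
  have "computable_in X (indicator X)"
    by (simp add: computable_in_def partial_recursive_in.query)
  from computable_in_compose[OF this assms] show ?thesis
    by (simp add: decidable_in_def indicator_def)
qed

text \<open>The three arguments of the recursion body are packed exactly as in
  \<open>prim_rec\<close>. With the parameter \<open>n\<close> kept separate from the bound
  \<open>b n\<close>, the rule applies to any \<open>rec_nat\<close> term by unification.\<close>

lemma computable_in_rec_nat: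
  assumes f: "computable_in X f" and b: "computable_in X b"
    and g: "computable_in X
      (\<lambda>w. g (fst (prod_decode w)) (fst (prod_decode (snd (prod_decode w))))
             (snd (prod_decode (snd (prod_decode w)))))"
  shows "computable_in X (\<lambda>n. rec_nat (f n) (\<lambda>i y. g n i y) (b n))"
proof -
  define g' where "g' = (\<lambda>w. g (fst (prod_decode w)) (fst (prod_decode (snd (prod_decode w))))
             (snd (prod_decode (snd (prod_decode w)))))"
  have rec: "prim_rec (\<lambda>n. Some (f n)) (\<lambda>n. Some (g' n)) a n
      = Some (rec_nat (f a) (\<lambda>i y. g a i y) n)" for a n
    by (induction n) (auto simp: g'_def)
  have "computable_in X (\<lambda>z. rec_nat (f (fst (prod_decode z)))
      (\<lambda>i y. g (fst (prod_decode z)) i y) (snd (prod_decode z)))"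
    using partial_recursive_in.prec[OF f[unfolded computable_in_def]
        g[folded g'_def, unfolded computable_in_def]]
    by (simp add: rec computable_in_def)
  from computable_in_compose[OF this computable_in_pair[OF computable_in_id b]]
  show ?thesis by simp
qed

lemmas computable_in_basic = computable_in_const computable_in_id computable_in_Suc
  computable_in_fst computable_in_snd computable_in_pair

section \<open>Arithmetic functions\<close>

lemma computable_in_add:
  assumes "computable_in X f" "computable_in X g"
  shows "computable_in X (\<lambda>n. f n + g n)"
proof -
  have eq: "a + b = rec_nat a (\<lambda>i y. Suc y) b" for a b :: nat
    by (induction b) auto
  show ?thesis unfolding eq by (intro computable_in_rec_nat computable_in_basic assms)
qed

lemma computable_in_mult:
  assumes "computable_in X f" "computable_in X g"
  shows "computable_in X (\<lambda>n. f n * g n)"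
proof -
  have eq: "a * b = rec_nat 0 (\<lambda>i y. y + a) b" for a b :: nat
    by (induction b) auto
  show ?thesis unfolding eq
    by (intro computable_in_rec_nat computable_in_add computable_in_basic
        computable_in_compose[OF assms(1)] assms)
qed

lemma computable_in_diff:
  assumes "computable_in X f" "computable_in X g"
  shows "computable_in X (\<lambda>n. f n - g n)"
proof -
  \<comment> \<open>Truncated subtraction iterates the predecessor, which is itself a recursion that
    discards its accumulator.\<close>
  have pred: "rec_nat 0 (\<lambda>i y. i) a = a - 1" for a :: nat
    by (cases a) auto
  have eq: "a - b = rec_nat a (\<lambda>i y. rec_nat 0 (\<lambda>i y. i) y) b" for a b :: nat
    unfolding pred by (induction b) auto
  show ?thesis unfolding eq by (intro computable_in_rec_nat computable_in_basic assms)
qed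

lemma computable_in_power:
  assumes "computable_in X f" "computable_in X g"
  shows "computable_in X (\<lambda>n. f n ^ g n)"
proof -
  have eq: "a ^ b = rec_nat 1 (\<lambda>i y. y * a) b" for a b :: nat
    by (induction b) auto
  show ?thesis unfolding eq
    by (intro computable_in_rec_nat computable_in_mult computable_in_basic
        computable_in_compose[OF assms(1)] assms)
qed

lemma computable_in_sum:
  assumes b: "computable_in X b"
    and g: "computable_in X (\<lambda>w. g (fst (prod_decode w)) (snd (prod_decode w)))"
  shows "computable_in X (\<lambda>n. \<Sum>i<b n. g n i)"
proof -
  have eq: "(\<Sum>i<b. g n i) = rec_nat 0 (\<lambda>i y. y + g n i) b" for n b
    by (induction b) auto
  \<comment> \<open>The recursion body receives the packed triple (n, i, y), while \<open>g\<close>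
    expects the packed pair (n, i), so the argument is repacked.\<close>
  have "computable_in X (\<lambda>w. g (fst (prod_decode w)) (fst (prod_decode (snd (prod_decode w)))))"
    using computable_in_compose[OF g, of "\<lambda>w. prod_encode (fst (prod_decode w), fst (prod_decode (snd (prod_decode w))))"]
    by (simp add: computable_in_basic)
  then show ?thesis unfolding eq
    by (intro computable_in_rec_nat computable_in_add computable_in_basic assms)
qed

section \<open>Decidable predicates, bounded quantifiers and search\<close>

lemma decidable_in_compose:
  "decidable_in X P \<Longrightarrow> computable_in X g \<Longrightarrow> decidable_in X (\<lambda>n. P (g n))"
  unfolding decidable_in_def by (rule computable_in_compose)

lemma decidable_in_less:
  assumes "computable_in X f" "computable_in X g"
  shows "decidable_in X (\<lambda>n. f n < g n)"
proof -
  have eq: "of_bool (a < b) = 1 - (1 - (b - a))" for a b :: nat by simp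
  show ?thesis unfolding decidable_in_def eq
    by (intro computable_in_diff computable_in_const assms)
qed

lemma decidable_in_not:
  assumes "decidable_in X P"
  shows "decidable_in X (\<lambda>n. \<not> P n)"
proof -
  have eq: "of_bool (\<not> b) = 1 - (of_bool b :: nat)" for b by simp
  show ?thesis using assms unfolding decidable_in_def eq
    by (intro computable_in_diff computable_in_const)
qed

lemma decidable_in_conj:
  assumes "decidable_in X P" "decidable_in X Q"
  shows "decidable_in X (\<lambda>n. P n \<and> Q n)"
  using assms unfolding decidable_in_def of_bool_conj by (intro computable_in_mult)

lemma decidable_in_disj:
  assumes "decidable_in X P" "decidable_in X Q"
  shows "decidable_in X (\<lambda>n. P n \<or> Q n)"
proof -
  have eq: "(a \<or> b) = (\<not> (\<not> a \<and> \<not> b))" for a b by simp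
  show ?thesis using assms unfolding eq by (intro decidable_in_not decidable_in_conj)
qed

lemma decidable_in_imp:
  assumes "decidable_in X P" "decidable_in X Q"
  shows "decidable_in X (\<lambda>n. P n \<longrightarrow> Q n)"
  using assms unfolding imp_conv_disj by (intro decidable_in_not decidable_in_disj)

lemma decidable_in_iff:
  assumes "decidable_in X P" "decidable_in X Q"
  shows "decidable_in X (\<lambda>n. P n \<longleftrightarrow> Q n)"
  using assms unfolding iff_conv_conj_imp by (intro decidable_in_imp decidable_in_conj)

lemma decidable_in_le:
  assumes "computable_in X f" "computable_in X g"
  shows "decidable_in X (\<lambda>n. f n \<le> g n)"
  unfolding less_Suc_eq_le[symmetric]
  by (intro decidable_in_less computable_in_Suc assms)

lemma decidable_in_eq:
  assumes "computable_in X f" "computable_in X g"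
  shows "decidable_in X (\<lambda>n. f n = g n)"
  unfolding eq_iff by (intro decidable_in_le decidable_in_conj assms)

lemma decidable_in_ex_less:
  assumes b: "computable_in X b"
    and P: "decidable_in X (\<lambda>w. P (fst (prod_decode w)) (snd (prod_decode w)))"
  shows "decidable_in X (\<lambda>n. \<exists>i<b n. P n i)"
proof -
  have eq: "(\<exists>i<b. P n i) \<longleftrightarrow> 0 < (\<Sum>i<b. of_bool (P n i) :: nat)" for n b
    by (auto simp: card_gt_0_iff)
  show ?thesis unfolding eq
    by (intro decidable_in_less computable_in_const computable_in_sum b
        P[unfolded decidable_in_def])
qed

lemma decidable_in_all_less:
  assumes b: "computable_in X b"
    and P: "decidable_in X (\<lambda>w. P (fst (prod_decode w)) (snd (prod_decode w)))"
  shows "decidable_in X (\<lambda>n. \<forall>i<b n. P n i)"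
proof -
  have eq: "(\<forall>i<b. P n i) \<longleftrightarrow> \<not> (\<exists>i<b. \<not> P n i)" for n b by blast
  show ?thesis unfolding eq by (intro decidable_in_not decidable_in_ex_less assms)
qed

lemma decidable_in_ex_le:
  assumes "computable_in X b"
    and "decidable_in X (\<lambda>w. P (fst (prod_decode w)) (snd (prod_decode w)))"
  shows "decidable_in X (\<lambda>n. \<exists>i\<le>b n. P n i)"
  unfolding less_Suc_eq_le[symmetric]
  by (intro decidable_in_ex_less computable_in_Suc assms)

lemma decidable_in_all_le:
  assumes "computable_in X b"
    and "decidable_in X (\<lambda>w. P (fst (prod_decode w)) (snd (prod_decode w)))"
  shows "decidable_in X (\<lambda>n. \<forall>i\<le>b n. P n i)"
  unfolding less_Suc_eq_le[symmetric]
  by (intro decidable_in_all_less computable_in_Suc assms)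

text \<open>Minimization looks for a zero, so it is applied to the characteristic function of the
  negation. Its search ends everywhere because of \<open>ex\<close>; each later unbounded search has
  to supply this premise.\<close>

lemma computable_in_Least:
  assumes ex: "\<And>n. \<exists>i. P n i"
    and P: "decidable_in X (\<lambda>w. P (fst (prod_decode w)) (snd (prod_decode w)))"
  shows "computable_in X (\<lambda>n. LEAST i. P n i)"
proof -
  define h where
    "h = (\<lambda>w. Some (of_bool (\<not> P (fst (prod_decode w)) (snd (prod_decode w))) :: nat))"
  have "partial_recursive_in (indicator X) (minimize h)"
    using decidable_in_not[OF P] unfolding h_def decidable_in_def computable_in_def
    by (rule partial_recursive_in.mini)
  moreover have "minimize h n = Some (LEAST i. P n i)" for n
  proof -
    have "h (prod_encode (n, i)) = Some 0 \<longleftrightarrow> P n i" "h (prod_encode (n, i)) \<noteq> None" for i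
      by (auto simp: h_def)
    then show ?thesis using ex[of n] by (auto simp: minimize_def)
  qed
  then have "minimize h = (\<lambda>n. Some (LEAST i. P n i))" by (rule ext)
  ultimately show ?thesis by (simp add: computable_in_def)
qed

lemmas computable_in_intros = computable_in_basic computable_in_add computable_in_mult
  computable_in_diff computable_in_power computable_in_sum
  decidable_in_less decidable_in_le decidable_in_eq decidable_in_not
  decidable_in_conj decidable_in_disj decidable_in_imp decidable_in_iff
  decidable_in_ex_less decidable_in_all_less decidable_in_ex_le decidable_in_all_le

lemma decidable_in_mod_eq:
  assumes "computable_in X f" "computable_in X g" "computable_in X h"
  shows "decidable_in X (\<lambda>n. f n mod g n = h n)"
proof -
  \<comment> \<open>The quotient is found by a search bounded by the dividend. The first disjunct
    covers \<open>a mod 0 = a\<close>.\<close>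
  have eq: "a mod b = c \<longleftrightarrow> (b = 0 \<and> a = c) \<or> (c < b \<and> (\<exists>q\<le>a. a = q * b + c))"
    for a b c :: nat
  proof (cases "b = 0")
    case False
    have "a = a div b * b + a mod b" "a div b \<le> a" by simp_all
    with False show ?thesis by (metis mod_less mod_less_divisor mod_mult_self3 neq0_conv)
  qed simp
  show ?thesis unfolding eq
    by (intro computable_in_intros assms assms[THEN computable_in_compose])
qed

lemma decidable_in_set_decode:
  assumes "computable_in X f" "computable_in X g"
  shows "decidable_in X (\<lambda>n. f n \<in> set_decode (g n))"
proof -
  \<comment> \<open>The two inequalities pin \<open>q\<close> down as \<open>c div 2 ^ a\<close>,
    whose parity is the digit of \<open>c\<close> at place \<open>a\<close>.\<close>
  have eq: "a \<in> set_decode c \<longleftrightarrow> (\<exists>q\<le>c. q * 2 ^ a \<le> c \<and> c < Suc q * 2 ^ a \<and> q mod 2 = 1)"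
    (is "_ \<longleftrightarrow> ?R") for a c
  proof
    assume "a \<in> set_decode c"
    then have "c div 2 ^ a mod 2 = 1"
      by (simp add: set_decode_def odd_iff_mod_2_eq_one)
    moreover have "c div 2 ^ a \<le> c" "c div 2 ^ a * 2 ^ a \<le> c" "c < Suc (c div 2 ^ a) * 2 ^ a"
      using dividend_less_div_times[of "2 ^ a" c] by (auto simp: algebra_simps)
    ultimately show ?R by blast
  next
    assume ?R
    then obtain q where q: "q * 2 ^ a \<le> c" "c < Suc q * 2 ^ a" "q mod 2 = 1" by blast
    then have "c div 2 ^ a = q" by (intro div_nat_eqI) (auto simp: mult.commute)
    with q(3) show "a \<in> set_decode c"
      by (simp add: set_decode_def odd_iff_mod_2_eq_one)
  qed
  show ?thesis unfolding eq
    by (intro computable_in_intros decidable_in_mod_eq assms assms[THEN computable_in_compose])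
qed

lemma computable_in_card:
  assumes "computable_in X b"
    and "decidable_in X (\<lambda>w. P (fst (prod_decode w)) (snd (prod_decode w)))"
  shows "computable_in X (\<lambda>n. card {i. i < b n \<and> P n i})"
proof -
  have eq: "card {i. i < b \<and> P n i} = (\<Sum>i<b. of_bool (P n i))" for n b
    by (simp add: sum.If_cases of_bool_def Int_def)
  show ?thesis unfolding eq
    using assms by (intro computable_in_sum) (auto simp: decidable_in_def)
qed

section \<open>Oracles\<close>

lemma turing_le_iff: "A \<le>\<^sub>T B \<longleftrightarrow> decidable_in B (\<lambda>n. n \<in> A)"
proof -
  have "(indicator A :: nat \<Rightarrow> nat) = (\<lambda>n. of_bool (n \<in> A))"
    by (auto simp: indicator_def fun_eq_iff)
  then show ?thesis by (simp add: turing_le_def decidable_in_def)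
qed

text \<open>Only the query rule mentions the oracle, so a derivation can be replayed as soon as the
  new oracle computes the old one.\<close>

lemma partial_recursive_in_mono:
  assumes "partial_recursive_in h f" and h: "partial_recursive_in h' (\<lambda>n. Some (h n))"
  shows "partial_recursive_in h' f"
  using assms(1) by induction (auto intro: partial_recursive_in.intros h)

lemma computable_in_mono: "computable_in X f \<Longrightarrow> X \<le>\<^sub>T Y \<Longrightarrow> computable_in Y f"
  unfolding computable_in_def turing_le_def by (rule partial_recursive_in_mono)

lemma decidable_in_mono: "decidable_in X P \<Longrightarrow> X \<le>\<^sub>T Y \<Longrightarrow> decidable_in Y P"
  unfolding decidable_in_def by (rule computable_in_mono)

lemma turing_le_join1: "A \<le>\<^sub>T turing_join A B"
proof -
  have "n \<in> A \<longleftrightarrow> 2 * n \<in> turing_join A B" for n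
    using inj_image_mem_iff[OF inj_sum_encode, of "Inl n" "A <+> B"]
    by (simp add: turing_join_def sum_encode_def Plus_def image_iff)
  then show ?thesis unfolding turing_le_iff by (simp add: decidable_in_oracle computable_in_intros)
qed

lemma turing_le_join2: "B \<le>\<^sub>T turing_join A B"
proof -
  have "n \<in> B \<longleftrightarrow> Suc (2 * n) \<in> turing_join A B" for n
    using inj_image_mem_iff[OF inj_sum_encode, of "Inr n" "A <+> B"]
    by (simp add: turing_join_def sum_encode_def Plus_def image_iff)
  then show ?thesis unfolding turing_le_iff by (simp add: decidable_in_oracle computable_in_intros)
qed

lemma computable_in_graph: "computable_in (graph_of f) f"
proof -
  have "f n = (LEAST y. prod_encode (n, y) \<in> graph_of f)" for n
    by (rule Least_equality[symmetric]) (auto simp: graph_of_def)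
  then have eq: "f = (\<lambda>n. LEAST y. prod_encode (n, y) \<in> graph_of f)" by blast
  show ?thesis by (subst eq, intro computable_in_Least decidable_in_oracle computable_in_intros)
    (auto simp: graph_of_def)
qed

lemma graph_turing_le:
  assumes "computable_in X f"
  shows "graph_of f \<le>\<^sub>T X"
proof -
  have eq: "n \<in> graph_of f \<longleftrightarrow> f (fst (prod_decode n)) = snd (prod_decode n)" for n
    by (auto simp: graph_of_def image_iff)
      (metis prod.collapse prod_decode_inverse)
  show ?thesis unfolding turing_le_iff eq
    by (intro computable_in_intros assms[THEN computable_in_compose])
qed

lemma decidable_in_infinite_join:
  assumes "infinite_join A \<le>\<^sub>T X" "computable_in X f" "computable_in X g"
  shows "decidable_in X (\<lambda>n. g n \<in> A (f n))"
proof -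
  have "g n \<in> A (f n) \<longleftrightarrow> prod_encode (f n, g n) \<in> infinite_join A" for n
    by (auto simp: infinite_join_def)
  then show ?thesis
    using decidable_in_compose[OF assms(1)[unfolded turing_le_iff] computable_in_pair[OF assms(2,3)]]
    by simp
qed

lemma turing_ideal_join: "turing_ideal M \<Longrightarrow> A \<in> M \<Longrightarrow> B \<in> M \<Longrightarrow> turing_join A B \<in> M"
  by (simp add: turing_ideal_def)

lemma turing_ideal_down: "turing_ideal M \<Longrightarrow> A \<le>\<^sub>T B \<Longrightarrow> B \<in> M \<Longrightarrow> A \<in> M"
  unfolding turing_ideal_def by blast

section \<open>An enumeration of the computable functions\<close>

text \<open>
  A computation is certified by a finite set of triples (index, argument, value), coded by a number
  through \<^const>\<open>set_decode\<close>, in which every triple is justified by other triples of the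
  set. No order on the set is needed: a justification appeals only to smaller indices, or to the same
  index with a smaller recursion argument.
\<close>

abbreviation triple :: "nat \<Rightarrow> nat \<Rightarrow> nat \<Rightarrow> nat" where
  "triple e n y \<equiv> prod_encode (e, prod_encode (n, y))"

text \<open>An index packs a tag with two subindices. The tags 0 to 8 follow the introduction rules
  of \<open>partial_recursive_in\<close>, with tag 7 split into the base and the step of a
  recursion. The bounds by \<open>c\<close> lose nothing, since a triple in
  \<open>set_decode c\<close> has all its entries below \<open>c\<close>; they make the predicate
  decidable in \<open>X\<close>.\<close>

definition justified :: "nat set \<Rightarrow> nat \<Rightarrow> nat \<Rightarrow> nat \<Rightarrow> nat \<Rightarrow> bool" where
  "justified X c e n y \<longleftrightarrow>
     (fst (prod_decode e) = 0 \<and> y = 0) \<or>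
     (fst (prod_decode e) = 1 \<and> y = Suc n) \<or>
     (fst (prod_decode e) = 2 \<and> y = fst (prod_decode n)) \<or>
     (fst (prod_decode e) = 3 \<and> y = snd (prod_decode n)) \<or>
     (fst (prod_decode e) = 4 \<and> (n \<in> X \<and> y = 1 \<or> n \<notin> X \<and> y = 0)) \<or>
     (fst (prod_decode e) = 5 \<and>
       (\<exists>u<c. \<exists>v<c. triple (fst (prod_decode (snd (prod_decode e)))) n u \<in> set_decode c \<and>
          triple (snd (prod_decode (snd (prod_decode e)))) n v \<in> set_decode c \<and>
          y = prod_encode (u, v))) \<or>
     (fst (prod_decode e) = 6 \<and>
       (\<exists>u<c. triple (snd (prod_decode (snd (prod_decode e)))) n u \<in> set_decode c \<and>
          triple (fst (prod_decode (snd (prod_decode e)))) u y \<in> set_decode c)) \<or>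
     (fst (prod_decode e) = 7 \<and> snd (prod_decode n) = 0 \<and>
       triple (fst (prod_decode (snd (prod_decode e)))) (fst (prod_decode n)) y \<in> set_decode c) \<or>
     (fst (prod_decode e) = 7 \<and> snd (prod_decode n) \<noteq> 0 \<and>
       (\<exists>v<c. triple e (prod_encode (fst (prod_decode n), snd (prod_decode n) - 1)) v
            \<in> set_decode c \<and>
          triple (snd (prod_decode (snd (prod_decode e))))
            (prod_encode (fst (prod_decode n), prod_encode (snd (prod_decode n) - 1, v))) y
            \<in> set_decode c)) \<or>
     (fst (prod_decode e) = 8 \<and>
       triple (fst (prod_decode (snd (prod_decode e)))) (prod_encode (n, y)) 0 \<in> set_decode c \<and>
       (\<forall>i<y. \<exists>v<c. v \<noteq> 0 \<and>
          triple (fst (prod_decode (snd (prod_decode e)))) (prod_encode (n, i)) v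
            \<in> set_decode c))"

definition certificate :: "nat set \<Rightarrow> nat \<Rightarrow> bool" where
  "certificate X c \<longleftrightarrow>
     (\<forall>t<c. t \<in> set_decode c \<longrightarrow> justified X c (fst (prod_decode t))
        (fst (prod_decode (snd (prod_decode t)))) (snd (prod_decode (snd (prod_decode t)))))"

text \<open>This is not monotone in \<open>c\<close>: a larger number need not code a certificate.
  Hence the stages below are expressed by a search for some \<open>c\<close> up to a bound.\<close>

definition halts :: "nat set \<Rightarrow> nat \<Rightarrow> nat \<Rightarrow> nat \<Rightarrow> bool" where
  "halts X e n c \<longleftrightarrow> certificate X c \<and> (\<exists>y<c. triple e n y \<in> set_decode c)"

lemma decidable_in_halts:
  assumes "computable_in X f" "computable_in X g" "computable_in X h"
  shows "decidable_in X (\<lambda>z. halts X (f z) (g z) (h z))"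
  unfolding halts_def certificate_def justified_def
  by (intro computable_in_intros decidable_in_set_decode decidable_in_oracle
      assms assms[THEN computable_in_compose])

section \<open>Bounds, monotonicity and unions of certificates\<close>

lemma set_decode_less:
  assumes "t \<in> set_decode c"
  shows "t < c"
proof -
  have "c div 2 ^ t \<noteq> 0" using assms by (auto simp: set_decode_def intro: ccontr)
  then have "2 ^ t \<le> c" by (simp add: div_eq_0_iff not_less)
  then show ?thesis using less_exp[of t] by linarith
qed

lemma triple_less:
  assumes "triple e n y \<in> set_decode c"
  shows "e < c" "n < c" "y < c"
  using set_decode_less[OF assms] le_prod_encode_1[of e "prod_encode (n, y)"]
    le_prod_encode_2[of "prod_encode (n, y)" e] le_prod_encode_1[of n y] le_prod_encode_2[of y n]
  by linarith+

lemma certificate_justified: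
  assumes "certificate X c" "triple e n y \<in> set_decode c"
  shows "justified X c e n y"
  using assms(1)[unfolded certificate_def, rule_format, OF set_decode_less[OF assms(2)] assms(2)]
  by simp

text \<open>Membership in \<open>set_decode c\<close> and the bounds by \<open>c\<close> occur only
  positively, and a larger set has a larger code. Therefore certificates can be united and
  extended.\<close>

lemma justified_mono:
  assumes "justified X c e n y" "set_decode c \<subseteq> set_decode d"
  shows "justified X d e n y"
proof -
  have "c \<le> d" by (rule subset_decode_imp_le[OF assms(2)])
  then have less: "u < c \<longrightarrow> u < d" for u by simp
  have mem: "t \<in> set_decode c \<longrightarrow> t \<in> set_decode d" for t using assms(2) by blast
  have "justified X c e n y \<longrightarrow> justified X d e n y"
    unfolding justified_def
    by (intro imp_refl less mem disj_mono conj_mono ex_mono all_mono imp_mono)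
  with assms(1) show ?thesis by blast
qed

lemma certificate_Un:
  assumes "certificate X c" "certificate X d"
  shows "\<exists>b. certificate X b \<and> set_decode b = set_decode c \<union> set_decode d"
proof -
  define b where "b = set_encode (set_decode c \<union> set_decode d)"
  have b: "set_decode b = set_decode c \<union> set_decode d" by (simp add: b_def)
  have "certificate X b" unfolding certificate_def
  proof (intro allI impI)
    fix t assume t: "t \<in> set_decode b"
    show "justified X b (fst (prod_decode t)) (fst (prod_decode (snd (prod_decode t))))
        (snd (prod_decode (snd (prod_decode t))))"
    proof (cases "t \<in> set_decode c")
      case True
      from assms(1)[unfolded certificate_def, rule_format, OF set_decode_less[OF True] True]
      show ?thesis by (rule justified_mono) (simp add: b)
    next
      case False
      with t b have d: "t \<in> set_decode d" by blast
      from assms(2)[unfolded certificate_def, rule_format, OF set_decode_less[OF d] d]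
      show ?thesis by (rule justified_mono) (simp add: b)
    qed
  qed
  with b show ?thesis by blast
qed

lemma certificate_insert:
  assumes "certificate X c" "justified X c e n y"
  shows "\<exists>d. certificate X d \<and> triple e n y \<in> set_decode d"
proof -
  define d where "d = set_encode (insert (triple e n y) (set_decode c))"
  have d: "set_decode d = insert (triple e n y) (set_decode c)" by (simp add: d_def)
  then have sub: "set_decode c \<subseteq> set_decode d" by blast
  have "certificate X d" unfolding certificate_def
  proof (intro allI impI)
    fix t assume t: "t \<in> set_decode d"
    show "justified X d (fst (prod_decode t)) (fst (prod_decode (snd (prod_decode t))))
        (snd (prod_decode (snd (prod_decode t))))"
    proof (cases "t \<in> set_decode c")
      case True
      from assms(1)[unfolded certificate_def, rule_format, OF set_decode_less[OF True] True] sub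
      show ?thesis by (rule justified_mono)
    next
      case False
      with t d have "t = triple e n y" by blast
      with justified_mono[OF assms(2) sub] show ?thesis by simp
    qed
  qed
  with d show ?thesis by blast
qed

text \<open>Needed for minimization, whose justification inspects an unspecified finite number of
  values.\<close>

lemma certificate_all_less:
  assumes "\<And>i. i < (k :: nat) \<Longrightarrow> \<exists>c. certificate X c \<and> t i \<in> set_decode c"
  shows "\<exists>c. certificate X c \<and> (\<forall>i<k. t i \<in> set_decode c)"
  using assms
proof (induction k)
  case 0
  have "certificate X 0" by (simp add: certificate_def)
  then show ?case by blast
next
  case (Suc k)
  obtain c where c: "certificate X c" "\<forall>i<k. t i \<in> set_decode c"
    using Suc.IH Suc.prems less_SucI by blast
  obtain d where d: "certificate X d" "t k \<in> set_decode d" using Suc.prems by blast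
  from certificate_Un[OF c(1) d(1)] c(2) d(2) show ?case
    unfolding less_Suc_eq by blast
qed

section \<open>Indices for all partial recursive functions\<close>

definition represents :: "nat set \<Rightarrow> nat \<Rightarrow> (nat \<rightharpoonup> nat) \<Rightarrow> bool" where
  "represents X e f \<longleftrightarrow>
     (\<forall>n y. f n = Some y \<longleftrightarrow> (\<exists>c. certificate X c \<and> triple e n y \<in> set_decode c))"

text \<open>Only the last step of a computation has to be examined: a triple of a certificate is
  justified there, and a justified triple can be added to it.\<close>

lemma representsI:
  assumes sound: "\<And>c n y. certificate X c \<Longrightarrow> triple e n y \<in> set_decode c \<Longrightarrow>
      justified X c e n y \<Longrightarrow> f n = Some y"
    and complete: "\<And>n y. f n = Some y \<Longrightarrow> \<exists>c. certificate X c \<and> justified X c e n y"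
  shows "represents X e f"
  unfolding represents_def
  using assms certificate_justified certificate_insert by blast

lemma represents_sound:
  "represents X e f \<Longrightarrow> certificate X c \<Longrightarrow> triple e n y \<in> set_decode c \<Longrightarrow> f n = Some y"
  unfolding represents_def by blast

lemma represents_complete:
  assumes "represents X e f" "f n = Some y"
  obtains c where "certificate X c" "triple e n y \<in> set_decode c"
  using assms unfolding represents_def by blast

lemma certificate_two:
  assumes "certificate X c" "s \<in> set_decode c" "certificate X d" "t \<in> set_decode d"
  obtains b where "certificate X b" "s \<in> set_decode b" "t \<in> set_decode b"
  using certificate_Un[OF assms(1,3)] assms(2,4) by blast

lemma represents_simple:
  assumes "\<And>c n y. justified X c e n y \<longleftrightarrow> f n = Some y"
  shows "represents X e f"
proof (rule representsI)
  have "certificate X 0" by (simp add: certificate_def)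
  then show "\<exists>c. certificate X c \<and> justified X c e n y" if "f n = Some y" for n y
    using assms that by blast
qed (use assms in blast)

lemma represents_pair:
  assumes f: "represents X a f" and g: "represents X b g"
  shows "represents X (prod_encode (5, prod_encode (a, b)))
    (\<lambda>n. Option.bind (f n) (\<lambda>x. Option.bind (g n) (\<lambda>y. Some (prod_encode (x, y)))))"
    (is "represents X ?e ?h")
proof (rule representsI)
  fix c n y
  assume "certificate X c" "justified X c ?e n y"
  then show "?h n = Some y"
    using represents_sound[OF f] represents_sound[OF g] by (fastforce simp: justified_def)
next
  fix n y
  assume "?h n = Some y"
  then obtain u v where uv: "f n = Some u" "g n = Some v" "y = prod_encode (u, v)"
    by (auto simp: bind_eq_Some_conv)
  obtain c where "certificate X c" "triple a n u \<in> set_decode c"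
    by (rule represents_complete[OF f uv(1)])
  moreover obtain d where "certificate X d" "triple b n v \<in> set_decode d"
    by (rule represents_complete[OF g uv(2)])
  ultimately obtain z where z: "certificate X z" "triple a n u \<in> set_decode z"
    "triple b n v \<in> set_decode z"
    by (rule certificate_two)
  then have "justified X z ?e n y"
    using triple_less(3)[OF z(2)] triple_less(3)[OF z(3)] uv(3) by (auto simp: justified_def)
  with z(1) show "\<exists>c. certificate X c \<and> justified X c ?e n y" by blast
qed

lemma represents_comp:
  assumes f: "represents X a f" and g: "represents X b g"
  shows "represents X (prod_encode (6, prod_encode (a, b))) (\<lambda>n. Option.bind (g n) f)"
    (is "represents X ?e ?h")
proof (rule representsI)
  fix c n y
  assume "certificate X c" "justified X c ?e n y"
  then show "?h n = Some y"
    using represents_sound[OF f] represents_sound[OF g] by (fastforce simp: justified_def)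
next
  fix n y
  assume "?h n = Some y"
  then obtain u where u: "g n = Some u" "f u = Some y"
    by (auto simp: bind_eq_Some_conv)
  obtain c where "certificate X c" "triple b n u \<in> set_decode c"
    by (rule represents_complete[OF g u(1)])
  moreover obtain d where "certificate X d" "triple a u y \<in> set_decode d"
    by (rule represents_complete[OF f u(2)])
  ultimately obtain z where z: "certificate X z" "triple b n u \<in> set_decode z"
    "triple a u y \<in> set_decode z"
    by (rule certificate_two)
  then have "justified X z ?e n y"
    using triple_less(3)[OF z(2)] by (auto simp: justified_def)
  with z(1) show "\<exists>c. certificate X c \<and> justified X c ?e n y" by blast
qed

text \<open>A recursion triple may appeal to its own index at a smaller recursion argument, so
  one-step reasoning as in \<open>representsI\<close> is replaced by induction on that argument, in
  both directions.\<close>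

lemma represents_prec:
  assumes f: "represents X a f" and g: "represents X b g"
  shows "represents X (prod_encode (7, prod_encode (a, b)))
    (\<lambda>n. prim_rec f g (fst (prod_decode n)) (snd (prod_decode n)))"
    (is "represents X ?e _")
proof -
  have sound: "prim_rec f g m k = Some y"
    if "certificate X c" "triple ?e (prod_encode (m, k)) y \<in> set_decode c" for c m k y
    using that(2)
  proof (induction k arbitrary: y)
    case 0
    from certificate_justified[OF that(1) 0] show ?case
      using represents_sound[OF f that(1)] by (auto simp: justified_def)
  next
    case (Suc k)
    from certificate_justified[OF that(1) Suc.prems] show ?case
      using represents_sound[OF g that(1)] Suc.IH by (auto simp: justified_def)
  qed
  have complete: "\<exists>c. certificate X c \<and> triple ?e (prod_encode (m, k)) y \<in> set_decode c"
    if "prim_rec f g m k = Some y" for m k y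
    using that
  proof (induction k arbitrary: y)
    case 0
    then have "f m = Some y" by simp
    with f obtain c where c: "certificate X c" "triple a m y \<in> set_decode c"
      by (rule represents_complete)
    then have "justified X c ?e (prod_encode (m, 0)) y" by (simp add: justified_def)
    with c(1) show ?case by (rule certificate_insert)
  next
    case (Suc k)
    then obtain v where v: "prim_rec f g m k = Some v"
      "g (prod_encode (m, prod_encode (k, v))) = Some y"
      by (auto simp: bind_eq_Some_conv)
    obtain c where "certificate X c" "triple ?e (prod_encode (m, k)) v \<in> set_decode c"
      using Suc.IH[OF v(1)] by blast
    moreover obtain d where "certificate X d"
      "triple b (prod_encode (m, prod_encode (k, v))) y \<in> set_decode d"
      by (rule represents_complete[OF g v(2)])
    ultimately obtain z where z: "certificate X z"
      "triple ?e (prod_encode (m, k)) v \<in> set_decode z"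
      "triple b (prod_encode (m, prod_encode (k, v))) y \<in> set_decode z"
      by (rule certificate_two)
    then have "justified X z ?e (prod_encode (m, Suc k)) y"
      using triple_less(3)[OF z(2)] by (auto simp: justified_def)
    with z(1) show ?case by (rule certificate_insert)
  qed
  have "n = prod_encode (fst (prod_decode n), snd (prod_decode n))" for n by simp
  then show ?thesis unfolding represents_def using sound complete by metis
qed

text \<open>Removes \<open>LEAST\<close> and puts minimization into the shape of the clause for tag
  8 in \<open>justified\<close>.\<close>

lemma minimize_eq_Some_iff:
  "minimize f n = Some y \<longleftrightarrow>
     f (prod_encode (n, y)) = Some 0 \<and> (\<forall>i<y. \<exists>v. v \<noteq> 0 \<and> f (prod_encode (n, i)) = Some v)"
    (is "_ \<longleftrightarrow> ?R")
proof
  assume min: "minimize f n = Some y"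
  then obtain k where k: "f (prod_encode (n, k)) = Some 0"
      "\<forall>i<k. f (prod_encode (n, i)) \<noteq> None"
    by (auto simp: minimize_def split: if_splits)
  from min have y: "y = (LEAST k. f (prod_encode (n, k)) = Some 0)"
    by (auto simp: minimize_def split: if_splits)
  have "f (prod_encode (n, y)) = Some 0" unfolding y by (rule LeastI) (rule k(1))
  moreover have "y \<le> k" unfolding y by (rule Least_le) (rule k(1))
  moreover have "f (prod_encode (n, i)) \<noteq> Some 0" if "i < y" for i
    using that unfolding y by (rule not_less_Least)
  ultimately show ?R using k(2) by (metis not_None_eq order_less_le_trans)
next
  assume R: ?R
  then have "(LEAST k. f (prod_encode (n, k)) = Some 0) = y"
    by (intro Least_equality) (auto simp: not_less[symmetric])
  moreover have "\<forall>i<y. f (prod_encode (n, i)) \<noteq> None" using R by auto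
  ultimately show "minimize f n = Some y" using R by (auto simp: minimize_def)
qed

lemma represents_mini:
  assumes f: "represents X a f"
  shows "represents X (prod_encode (8, prod_encode (a, 0))) (minimize f)"
    (is "represents X ?e _")
proof (rule representsI)
  fix c n y
  assume "certificate X c" "justified X c ?e n y"
  then show "minimize f n = Some y"
    using represents_sound[OF f] unfolding minimize_eq_Some_iff
    by (fastforce simp: justified_def)
next
  fix n y
  assume "minimize f n = Some y"
  then obtain v where v0: "f (prod_encode (n, y)) = Some 0"
    and v: "\<And>i. i < y \<Longrightarrow> v i \<noteq> 0 \<and> f (prod_encode (n, i)) = Some (v i)"
    unfolding minimize_eq_Some_iff by metis
  have "\<exists>c. certificate X c \<and> triple a (prod_encode (n, i)) (v i) \<in> set_decode c" if "i < y" for i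
    using represents_complete[OF f conjunct2[OF v[OF that]]] by blast
  then obtain c where "certificate X c"
    "\<forall>i<y. triple a (prod_encode (n, i)) (v i) \<in> set_decode c"
    using certificate_all_less[of y X "\<lambda>i. triple a (prod_encode (n, i)) (v i)"] by blast
  moreover obtain d where "certificate X d" "triple a (prod_encode (n, y)) 0 \<in> set_decode d"
    by (rule represents_complete[OF f v0])
  ultimately obtain z where z: "certificate X z"
    "\<forall>i<y. triple a (prod_encode (n, i)) (v i) \<in> set_decode z"
    "triple a (prod_encode (n, y)) 0 \<in> set_decode z"
    using certificate_Un[of X c d] by blast
  have "\<exists>u<z. u \<noteq> 0 \<and> triple a (prod_encode (n, i)) u \<in> set_decode z" if "i < y" for i
    using z(2) v triple_less(3) that by blast
  then have "justified X z ?e n y" using z(3) by (simp add: justified_def)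
  with z(1) show "\<exists>c. certificate X c \<and> justified X c ?e n y" by blast
qed

lemma partial_recursive_in_represented:
  assumes "partial_recursive_in (indicator X) f"
  shows "\<exists>e. represents X e f"
  using assms
proof induction
  case zero
  show ?case by (rule exI[of _ "prod_encode (0, 0)"], rule represents_simple) (auto simp: justified_def)
next
  case succ
  show ?case by (rule exI[of _ "prod_encode (1, 0)"], rule represents_simple) (auto simp: justified_def)
next
  case left
  show ?case by (rule exI[of _ "prod_encode (2, 0)"], rule represents_simple) (auto simp: justified_def)
next
  case right
  show ?case by (rule exI[of _ "prod_encode (3, 0)"], rule represents_simple) (auto simp: justified_def)
next
  case query
  show ?case by (rule exI[of _ "prod_encode (4, 0)"], rule represents_simple)
      (auto simp: justified_def indicator_def)
qed (use represents_pair represents_comp represents_prec represents_mini in blast)+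

text \<open>A value lies below every certificate that contains it, so a bound on some certificate
  bounds the value. Domination requires no more than this.\<close>

lemma computable_in_indexed:
  assumes "computable_in X g"
  obtains e where "\<And>n. \<exists>c. halts X e n c" "\<And>n c. halts X e n c \<Longrightarrow> g n < c"
proof -
  from partial_recursive_in_represented[OF assms[unfolded computable_in_def]]
  obtain e where e: "represents X e (\<lambda>n. Some (g n))" ..
  have "\<exists>c. halts X e n c" for n
  proof -
    obtain c where "certificate X c" "triple e n (g n) \<in> set_decode c"
      by (rule represents_complete[OF e, of n "g n"]) simp
    then have "halts X e n c" using triple_less(3) unfolding halts_def by blast
    then show ?thesis ..
  qed
  moreover have "g n < c" if "halts X e n c" for n c
    using that represents_sound[OF e] unfolding halts_def by fastforce
  ultimately show ?thesis by (rule that)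
qed

section \<open>Density\<close>

text \<open>Integer counts keep closeness decidable and avoid division by the length of the
  segment.\<close>

definition diff_count :: "nat set \<Rightarrow> nat set \<Rightarrow> nat \<Rightarrow> nat" where
  "diff_count X Y n = card (sym_diff X Y \<inter> {0..<n})"

lemma diff_count_commute: "diff_count X Y n = diff_count Y X n"
  by (simp add: diff_count_def Un_commute)

lemma diff_count_self [simp]: "diff_count X X n = 0"
  by (simp add: diff_count_def)

lemma diff_count_triangle: "diff_count X Z n \<le> diff_count X Y n + diff_count Y Z n"
proof -
  have "diff_count X Z n \<le> card ((sym_diff X Y \<inter> {0..<n}) \<union> (sym_diff Y Z \<inter> {0..<n}))"
    unfolding diff_count_def by (rule card_mono) auto
  also have "\<dots> \<le> diff_count X Y n + diff_count Y Z n"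
    unfolding diff_count_def by (rule card_Un_le)
  finally show ?thesis .
qed

text \<open>A bound on a limsup holds for almost all terms only after it is enlarged; here it is
  doubled, which is the origin of the factor 2 in \<open>close_upto\<close>.\<close>

lemma eventually_diff_count_le:
  assumes "delta X Y \<le> ereal (1 / 2 ^ k)"
  shows "\<forall>\<^sub>F n in sequentially. diff_count X Y n * 2 ^ k \<le> 2 * n"
proof -
  have "ereal (1 / 2 ^ k) < ereal (2 / 2 ^ k)" by (simp add: divide_strict_right_mono)
  then have "\<forall>\<^sub>F n in sequentially. ereal (rho n (sym_diff X Y)) < ereal (2 / 2 ^ k)"
    using assms unfolding delta_def Limsup_le_iff by blast
  then show ?thesis
    using eventually_gt_at_top[of 0]
  proof eventually_elim
    case (elim n)
    then have "real (diff_count X Y n) * 2 ^ k < real (2 * n)"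
      by (simp add: rho_def diff_count_def field_simps)
    then have "real (diff_count X Y n * 2 ^ k) < real (2 * n)" by simp
    then show ?case unfolding of_nat_less_iff by simp
  qed
qed

text \<open>An additive constant vanishes in the limit after division by \<open>n\<close>. The
  threshold chosen in the proof makes \<open>c / n\<close> smaller than the gap between
  \<open>r\<close> and \<open>1 / 2 ^ k\<close>.\<close>

lemma delta_leI:
  assumes "\<And>n. diff_count X Y n * 2 ^ k \<le> n + c"
  shows "delta X Y \<le> ereal (1 / 2 ^ k)"
  unfolding delta_def Limsup_le_iff
proof (intro allI impI)
  fix y assume "ereal (1 / 2 ^ k) < y"
  then obtain r where r: "1 / 2 ^ k < r" "ereal r < y"
    by (metis ereal_dense2 ereal_less_ereal_Ex less_ereal.simps(1) order_less_trans ereal_less(2))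
  show "\<forall>\<^sub>F n in sequentially. ereal (rho n (sym_diff X Y)) < y"
    using eventually_gt_at_top[of "nat \<lceil>real c / (r - 1 / 2 ^ k)\<rceil>"]
  proof eventually_elim
    case (elim n)
    have "real c / (r - 1 / 2 ^ k) < real n" using elim by linarith
    then have n: "real c < real n * (r - 1 / 2 ^ k)" using r(1) by (simp add: pos_divide_less_eq)
    have "real (diff_count X Y n) * 2 ^ k \<le> real n + real c"
      using of_nat_mono[OF assms[of n], where ?'a = real] by simp
    then have "real (diff_count X Y n) \<le> real n / 2 ^ k + real c / 2 ^ k"
      by (simp add: field_simps)
    moreover have "real c / 2 ^ k \<le> real c" by (simp add: divide_le_eq mult_le_cancel_left1)
    ultimately have "real (diff_count X Y n) < r * real n"
      using n by (simp add: algebra_simps)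
    moreover have "0 < n" using elim by simp
    ultimately have "rho n (sym_diff X Y) < r"
      by (simp add: rho_def diff_count_def pos_divide_less_eq)
    then show ?case using r(2) by (meson ereal_less_le less_ereal.simps(1) order_less_trans)
  qed
qed

lemma card_multiples_le:
  assumes "m > (0 :: nat)"
  shows "card {x. x < n \<and> m dvd x} * m \<le> n + m"
proof -
  have "{x. x < n \<and> m dvd x} \<subseteq> (\<lambda>q. q * m) ` {..n div m}"
  proof
    fix x assume "x \<in> {x. x < n \<and> m dvd x}"
    then have "x = x div m * m" "x div m \<le> n div m" by (auto intro: div_le_mono)
    then show "x \<in> (\<lambda>q. q * m) ` {..n div m}" by blast
  qed
  then have "card {x. x < n \<and> m dvd x} \<le> card {..n div m}"
    by (rule surj_card_le[rotated]) simp
  then have "card {x. x < n \<and> m dvd x} * m \<le> Suc (n div m) * m"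
    by (intro mult_le_mono1) simp
  also have "\<dots> \<le> n + m" by simp
  finally show ?thesis .
qed

lemma card_residue_class_ge:
  assumes "r < (m :: nat)"
  shows "n \<le> card {x. x < n \<and> x mod m = r} * m + m"
proof -
  have "(\<lambda>q. q * m + r) ` {..<n div m} \<subseteq> {x. x < n \<and> x mod m = r}"
  proof clarify
    fix q assume "q < n div m"
    then have "Suc q * m \<le> n" by (metis Suc_leI assms less_eq_div_iff_mult_less_eq not_less0 not_gr0)
    then show "q * m + r < n \<and> (q * m + r) mod m = r" using assms by simp
  qed
  moreover have "inj_on (\<lambda>q. q * m + r) {..<n div m}" using assms by (auto simp: inj_on_def)
  ultimately have "n div m \<le> card {x. x < n \<and> x mod m = r}"
    using card_inj_on_le[of "\<lambda>q. q * m + r" "{..<n div m}"] by simp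
  then have "n div m * m \<le> card {x. x < n \<and> x mod m = r} * m" by (rule mult_le_mono1)
  moreover have "n \<le> n div m * m + m"
    using assms mod_less_divisor[of m n] div_mult_mod_eq[of n m] by linarith
  ultimately show ?thesis by linarith
qed

section \<open>Completeness implies domination\<close>

text \<open>
  The numbers with 2-adic valuation \<open>e\<close> (a set of density \<open>2 ^ - (e + 1)\<close>) carry the guess
  of stage \<open>i\<close> on whether the \<open>e\<close>-th function is total: its values up to \<open>i\<close> have to be seen.
\<close>

definition halting_set :: "nat set \<Rightarrow> nat \<Rightarrow> nat set" where
  "halting_set X i =
     {x. \<exists>e\<le>x. x mod 2 ^ Suc e = 2 ^ e \<and> (\<forall>n\<le>i. \<exists>c\<le>x. halts X e n c)}"

lemma infinite_join_halting_set: "infinite_join (halting_set X) \<le>\<^sub>T X"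
proof -
  have eq: "z \<in> infinite_join (halting_set X) \<longleftrightarrow>
      (\<exists>e\<le>snd (prod_decode z). snd (prod_decode z) mod 2 ^ Suc e = 2 ^ e \<and>
        (\<forall>n\<le>fst (prod_decode z). \<exists>c\<le>snd (prod_decode z). halts X e n c))" for z
  proof -
    obtain i x where "z = prod_encode (i, x)" by (metis prod_decode_inverse surj_pair)
    then show ?thesis by (simp add: infinite_join_def halting_set_def)
  qed
  show ?thesis unfolding turing_le_iff eq
    by (intro computable_in_intros decidable_in_mod_eq decidable_in_halts)
qed

text \<open>The congruence expresses that the 2-adic valuation of \<open>x\<close> is the exponent
  on the right.\<close>

lemma mod_power_Suc_unique:
  fixes x :: nat
  assumes "x mod 2 ^ Suc d = 2 ^ d" "x mod 2 ^ Suc e = 2 ^ e"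
  shows "d = e"
proof -
  have "\<not> d < e" if "x mod 2 ^ Suc d = 2 ^ d" "x mod 2 ^ Suc e = 2 ^ e" for d e
  proof
    assume "d < e"
    then have dvd: "(2 :: nat) ^ Suc d dvd 2 ^ e" by (intro le_imp_power_dvd) simp
    then have "(2 :: nat) ^ Suc d dvd x mod 2 ^ Suc e" using that(2) by simp
    moreover have "(2 :: nat) ^ Suc d dvd 2 ^ Suc e"
      unfolding power_Suc[of 2 e] using dvd by (rule dvd_mult)
    ultimately have "2 ^ Suc d dvd x" using dvd_mod_iff by blast
    then have "x mod 2 ^ Suc d = 0" by simp
    with that(1) show False by simp
  qed
  with assms show ?thesis by (meson linorder_neqE_nat)
qed

lemma halting_set_iff:
  assumes "x mod 2 ^ Suc e = 2 ^ e"
  shows "x \<in> halting_set X i \<longleftrightarrow> (\<forall>n\<le>i. \<exists>c\<le>x. halts X e n c)"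
proof -
  \<comment> \<open>The bound \<open>e \<le> x\<close> in \<open>halting_set\<close>, present for
    decidability, thus holds automatically.\<close>
  have "2 ^ e \<le> x" using assms mod_less_eq_dividend[of x "2 ^ Suc e"] by simp
  then have "e \<le> x" using less_exp[of e] by linarith
  then show ?thesis using assms mod_power_Suc_unique unfolding halting_set_def by blast
qed

lemma total_eventually_mem:
  assumes "\<And>n. \<exists>c. halts X e n c"
  shows "\<forall>\<^sub>F x in sequentially. x mod 2 ^ Suc e = 2 ^ e \<longrightarrow> x \<in> halting_set X i"
proof -
  obtain c where c: "\<And>n. halts X e n (c n)" using assms by metis
  have "\<forall>\<^sub>F x in sequentially. \<forall>n\<in>{..i}. c n \<le> x"
    by (intro eventually_ball_finite ballI eventually_ge_at_top) simp
  then show ?thesis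
    by eventually_elim (use c halting_set_iff in blast)
qed

lemma partial_not_mem:
  assumes "\<not> (\<exists>c. halts X e n c)" "n \<le> i" "x mod 2 ^ Suc e = 2 ^ e"
  shows "x \<notin> halting_set X i"
  using assms halting_set_iff by blast

text \<open>For each of the finitely many valuations below \<open>k\<close>, the sets from stage
  \<open>m\<close> on agree up to finitely many numbers. All other numbers in these sets are
  multiples of \<open>2 ^ k\<close>, which have density \<open>1 / 2 ^ k\<close>.\<close>

lemma delta_cauchy_halting_set: "delta_cauchy (halting_set X)"
  unfolding delta_cauchy_def
proof
  fix k
  \<comment> \<open>\<open>N e\<close> is a place of divergence if the function with index
    \<open>e\<close> is partial, and arbitrary otherwise. The sum \<open>m\<close> below serves as a
    common upper bound.\<close>
  define N where "N = (\<lambda>e. SOME n. \<not> (\<exists>c. halts X e n c))"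
  have N: "\<not> (\<exists>c. halts X e (N e) c)" if "\<not> (\<exists>c. halts X e n c)" for e n
    unfolding N_def using that by (rule someI)
  define m where "m = (\<Sum>e<k. N e)"
  have m: "N e \<le> m" if "e < k" for e
    unfolding m_def using that by (intro member_le_sum) auto
  have "delta (halting_set X m) (halting_set X n) \<le> ereal (1 / 2 ^ k)" if "n > m" for n
  proof -
    have "\<forall>\<^sub>F x in sequentially. x mod 2 ^ Suc e = 2 ^ e \<longrightarrow>
        (x \<in> halting_set X m \<longleftrightarrow> x \<in> halting_set X n)" if "e < k" for e
    proof (cases "\<forall>n. \<exists>c. halts X e n c")
      case True
      then show ?thesis
        using total_eventually_mem[of X e m] total_eventually_mem[of X e n]
        by (auto elim: eventually_elim2)
    next
      case False
      then have "\<not> (\<exists>c. halts X e (N e) c)" using N by blast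
      then show ?thesis
        using partial_not_mem m[OF \<open>e < k\<close>] \<open>n > m\<close>
        by (intro always_eventually) (meson less_imp_le le_trans)
    qed
    then have "\<forall>\<^sub>F x in sequentially. \<forall>e\<in>{..<k}. x mod 2 ^ Suc e = 2 ^ e \<longrightarrow>
        (x \<in> halting_set X m \<longleftrightarrow> x \<in> halting_set X n)"
      by (intro eventually_ball_finite) auto
    then obtain b where b: "\<And>x e. x \<ge> b \<Longrightarrow> e < k \<Longrightarrow> x mod 2 ^ Suc e = 2 ^ e \<Longrightarrow>
        x \<in> halting_set X m \<longleftrightarrow> x \<in> halting_set X n"
      unfolding eventually_sequentially by blast
    have dvd: "2 ^ k dvd x" if x: "x \<in> sym_diff (halting_set X m) (halting_set X n)" "x \<ge> b" for x
    proof -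
      obtain e where e: "x mod 2 ^ Suc e = 2 ^ e" using x(1) unfolding halting_set_def by blast
      then have "k \<le> e" using b[OF x(2)] x(1) by (meson Diff_iff UnE not_le)
      then have "(2 :: nat) ^ k dvd 2 ^ e" "(2 :: nat) ^ k dvd 2 ^ Suc e"
        by (auto intro: le_imp_power_dvd simp del: power_Suc)
      with e show ?thesis by (metis dvd_mod_iff)
    qed
    show ?thesis
    proof (rule delta_leI)
      fix s
      have "diff_count (halting_set X m) (halting_set X n) s
          \<le> card ({..<b} \<union> {x. x < s \<and> 2 ^ k dvd x})"
        unfolding diff_count_def by (rule card_mono) (use dvd in \<open>auto simp: not_less\<close>)
      also have "\<dots> \<le> b + card {x. x < s \<and> 2 ^ k dvd x}"
        using card_Un_le[of "{..<b}"] by simp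
      finally have "diff_count (halting_set X m) (halting_set X n) s * 2 ^ k
          \<le> (b + card {x. x < s \<and> 2 ^ k dvd x}) * 2 ^ k"
        by (rule mult_le_mono1)
      also have "\<dots> \<le> s + (b * 2 ^ k + 2 ^ k)"
        using card_multiples_le[of "2 ^ k" s] by (simp add: algebra_simps)
      finally show "diff_count (halting_set X m) (halting_set X n) s * 2 ^ k
          \<le> s + (b * 2 ^ k + 2 ^ k)" .
    qed
  qed
  then show "\<exists>m. \<forall>n>m. delta (halting_set X m) (halting_set X n) \<le> ereal (1 / 2 ^ k)"
    by blast
qed

section \<open>Reading totality from the density of a limit\<close>

lemma delta_limit_frequent:
  assumes "delta_limit A L"
  obtains i where "i \<ge> m" "\<forall>\<^sub>F s in sequentially. diff_count (A i) L s * 2 ^ k \<le> 2 * s"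
proof -
  obtain j where "\<And>n. n > j \<Longrightarrow> delta (A n) L \<le> ereal (1 / 2 ^ k)"
    using assms unfolding delta_limit_def by blast
  then have "delta (A (Suc (max j m))) L \<le> ereal (1 / 2 ^ k)" by simp
  from eventually_diff_count_le[OF this] show ?thesis by (intro that[of "Suc (max j m)"]) auto
qed

definition limit_count :: "nat set \<Rightarrow> nat \<Rightarrow> nat \<Rightarrow> nat" where
  "limit_count L e s = card {x. x < s \<and> x mod 2 ^ Suc e = 2 ^ e \<and> x \<in> L}"

text \<open>The class of valuation \<open>e\<close> has density \<open>1 / 2 ^ (e + 1)\<close>, and
  the threshold is a quarter of it. For \<open>i \<ge> n\<close> the set of stage \<open>i\<close>
  misses the class, so \<open>L\<close> meets it only in differences, at most one part in
  \<open>2 ^ (e + 4)\<close> of a long segment.\<close>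

lemma limit_count_partial:
  assumes L: "delta_limit (halting_set X) L" and e: "\<not> (\<exists>c. halts X e n c)"
  shows "\<forall>\<^sub>F s in sequentially. limit_count L e s * 2 ^ (e + 3) < s"
proof -
  obtain i where i: "i \<ge> n"
    "\<forall>\<^sub>F s in sequentially. diff_count (halting_set X i) L s * 2 ^ (e + 5) \<le> 2 * s"
    by (rule delta_limit_frequent[OF L])
  show ?thesis using i(2) eventually_gt_at_top[of 0]
  proof eventually_elim
    case (elim s)
    have "limit_count L e s \<le> diff_count (halting_set X i) L s"
      unfolding limit_count_def diff_count_def
      by (rule card_mono) (use partial_not_mem[OF e i(1)] in auto)
    then have "limit_count L e s * 2 ^ (e + 5) \<le> 2 * s"
      using elim(1) by (meson mult_le_mono1 order_trans)
    then have "16 * (limit_count L e s * 2 ^ e) \<le> s" by (simp add: power_add)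
    moreover have "limit_count L e s * 2 ^ (e + 3) = 8 * (limit_count L e s * 2 ^ e)"
      by (simp add: power_add)
    ultimately show ?case using elim(2) by linarith
  qed
qed

lemma limit_count_total:
  assumes L: "delta_limit (halting_set X) L" and e: "\<And>n. \<exists>c. halts X e n c"
  shows "\<forall>\<^sub>F s in sequentially. s \<le> limit_count L e s * 2 ^ (e + 3)"
proof -
  obtain i where i:
    "\<forall>\<^sub>F s in sequentially. diff_count (halting_set X i) L s * 2 ^ (e + 5) \<le> 2 * s"
    by (rule delta_limit_frequent[OF L])
  obtain b where b: "\<And>x. x \<ge> b \<Longrightarrow> x mod 2 ^ Suc e = 2 ^ e \<Longrightarrow> x \<in> halting_set X i"
    using total_eventually_mem[OF e, of i] unfolding eventually_sequentially by blast
  show ?thesis using i eventually_ge_at_top[of "(b + 1) * 2 ^ (e + 3)"]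
  proof eventually_elim
    case (elim s)
    define a where "a = card {x. x < s \<and> x mod 2 ^ Suc e = 2 ^ e}"
    let ?d = "diff_count (halting_set X i) L s"
    \<comment> \<open>Below \<open>s\<close> the class is covered by a finite exceptional part, the
      part inside \<open>L\<close>, and the differences. The first and the last together are too
      small to push the middle one under the threshold.\<close>
    have "a \<le> card ({..<b} \<union> {x. x < s \<and> x mod 2 ^ Suc e = 2 ^ e \<and> x \<in> L} \<union>
        (sym_diff (halting_set X i) L \<inter> {0..<s}))"
      unfolding a_def by (rule card_mono) (use b in \<open>auto simp: not_less\<close>)
    also have "\<dots> \<le> b + limit_count L e s + ?d"
      unfolding limit_count_def diff_count_def
      by (intro order_trans[OF card_Un_le] add_mono) (auto intro: order_trans[OF card_Un_le])
    finally have "a * 2 ^ e \<le> (b + limit_count L e s + ?d) * 2 ^ e" by (rule mult_le_mono1)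
    moreover have "s \<le> a * 2 ^ Suc e + 2 ^ Suc e"
      unfolding a_def by (rule card_residue_class_ge) simp
    ultimately show ?case using elim by (simp add: power_add algebra_simps)
  qed
qed

lemma delta_complete_imp_DOM:
  assumes M: "turing_ideal M" and complete: "delta_complete M"
  shows "DOM M"
  unfolding DOM_def
proof
  fix X assume X: "X \<in> M"
  have "infinite_join (halting_set X) \<in> M"
    using turing_ideal_down[OF M infinite_join_halting_set X] .
  then obtain L where L: "L \<in> M" "delta_limit (halting_set X) L"
    using complete delta_cauchy_halting_set unfolding delta_complete_def by blast
  define Z where "Z = turing_join X L"
  have Z: "Z \<in> M" unfolding Z_def using M X L(1) by (rule turing_ideal_join)
  have XZ: "X \<le>\<^sub>T Z" and LZ: "L \<le>\<^sub>T Z"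
    unfolding Z_def by (rule turing_le_join1 turing_le_join2)+
  \<comment> \<open>\<open>n \<le> s\<close> forces the search into the region where the guess of
    \<open>L\<close> about a total function is already right. If the function diverges at
    \<open>n\<close>, the second alternative eventually ends the search.\<close>
  define P where "P = (\<lambda>n e s. n \<le> s \<and>
      ((\<exists>c\<le>s. halts X e n c) \<or> limit_count L e s * 2 ^ (e + 3) < s))"
  have ex: "\<exists>s. P n e s" for n e
  proof (cases "\<exists>c. halts X e n c")
    case True
    then obtain c where "halts X e n c" ..
    moreover have "n \<le> max n c" "c \<le> max n c" by simp_all
    ultimately have "P n e (max n c)" unfolding P_def by blast
    then show ?thesis ..
  next
    case False
    have "\<forall>\<^sub>F s in sequentially. P n e s"
      using limit_count_partial[OF L(2) False] eventually_ge_at_top[of n]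
      by eventually_elim (simp add: P_def)
    then show ?thesis by (auto simp: eventually_sequentially)
  qed
  \<comment> \<open>The sum stands in for a maximum over all indices up to \<open>n\<close>.\<close>
  define f where "f = (\<lambda>n. \<Sum>e<Suc n. LEAST s. P n e s)"
  have "computable_in Z f"
    unfolding f_def P_def limit_count_def
    by (intro computable_in_sum computable_in_Least computable_in_card computable_in_intros
        decidable_in_mod_eq decidable_in_mono[OF decidable_in_halts XZ]
        decidable_in_compose[OF LZ[unfolded turing_le_iff]]
        ex[unfolded P_def limit_count_def])
  then have "graph_of f \<in> M"
    using turing_ideal_down[OF M graph_turing_le Z] by blast
  moreover have "dominates f g" if g: "computable_in X g" for g
  proof -
    obtain e where total: "\<And>n. \<exists>c. halts X e n c" and less: "\<And>n c. halts X e n c \<Longrightarrow> g n < c"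
      using computable_in_indexed[OF g] by blast
    obtain b where b: "\<And>s. s \<ge> b \<Longrightarrow> s \<le> limit_count L e s * 2 ^ (e + 3)"
      using limit_count_total[OF L(2) total] unfolding eventually_sequentially by blast
    \<comment> \<open>\<open>n \<ge> e\<close> puts the index among the summands, and
      \<open>n \<ge> b\<close> rules out the guess of partiality.\<close>
    have "g n \<le> f n" if "n \<ge> max b e" for n
    proof -
      define s where "s = (LEAST s. P n e s)"
      have "P n e s" unfolding s_def using ex by (rule LeastI_ex)
      then have "n \<le> s" "(\<exists>c\<le>s. halts X e n c) \<or> limit_count L e s * 2 ^ (e + 3) < s"
        unfolding P_def by auto
      with b[of s] that obtain c where "c \<le> s" "halts X e n c" by auto
      then have "g n \<le> s" using less by fastforce
      also have "s \<le> f n"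
        unfolding f_def s_def using that by (intro member_le_sum) auto
      finally show ?thesis .
    qed
    then show ?thesis unfolding dominates_def eventually_sequentially by blast
  qed
  ultimately show "\<exists>f. graph_of f \<in> M \<and> (\<forall>g. computable_in X g \<longrightarrow> dominates f g)" by blast
qed

section \<open>Domination implies completeness\<close>

text \<open>
  \<open>close_guess\<close> tests closeness on the window \<open>[u, f u]\<close> only; for a dominating
  \<open>f\<close> its limit in \<open>u\<close> is eventual closeness. Likewise \<open>modulus_guess\<close>
  holds eventually in \<open>u\<close>, for a dominating \<open>h\<close>, iff \<open>m\<close> is a modulus for \<open>k\<close>.
\<close>

definition close_upto :: "(nat \<Rightarrow> nat set) \<Rightarrow> nat \<Rightarrow> nat \<Rightarrow> nat \<Rightarrow> nat \<Rightarrow> bool" where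
  "close_upto A k m n s \<longleftrightarrow> diff_count (A m) (A n) s * 2 ^ k \<le> 2 * s"

definition close_guess ::
  "(nat \<Rightarrow> nat set) \<Rightarrow> (nat \<Rightarrow> nat) \<Rightarrow> nat \<Rightarrow> nat \<Rightarrow> nat \<Rightarrow> nat \<Rightarrow> bool" where
  "close_guess A f k m n u \<longleftrightarrow> (\<forall>s\<le>f u. u \<le> s \<longrightarrow> close_upto A k m n s)"

definition modulus_guess ::
  "(nat \<Rightarrow> nat set) \<Rightarrow> (nat \<Rightarrow> nat) \<Rightarrow> (nat \<Rightarrow> nat) \<Rightarrow> nat \<Rightarrow> nat \<Rightarrow> nat \<Rightarrow> bool" where
  "modulus_guess A f h k m u \<longleftrightarrow>
     (\<forall>n\<le>u. m < n \<longrightarrow> (\<exists>v\<le>h u. u \<le> v \<and> close_guess A f k m n v))"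

lemma decidable_in_close_upto:
  assumes A: "infinite_join A \<le>\<^sub>T X"
    and "computable_in X a" "computable_in X b" "computable_in X c" "computable_in X d"
  shows "decidable_in X (\<lambda>z. close_upto A (a z) (b z) (c z) (d z))"
proof -
  have eq: "diff_count (A m) (A n) s = card {x. x < s \<and> \<not> (x \<in> A m \<longleftrightarrow> x \<in> A n)}" for m n s
    unfolding diff_count_def by (rule arg_cong[where f = card]) auto
  show ?thesis unfolding close_upto_def eq
    by (intro computable_in_intros computable_in_card decidable_in_infinite_join[OF A]
        assms(2-) assms(2-)[THEN computable_in_compose])
qed

lemma decidable_in_close_guess:
  assumes A: "infinite_join A \<le>\<^sub>T X" and f: "computable_in X f"
    and "computable_in X a" "computable_in X b" "computable_in X c" "computable_in X d"
  shows "decidable_in X (\<lambda>z. close_guess A f (a z) (b z) (c z) (d z))"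
  unfolding close_guess_def
  by (intro computable_in_intros decidable_in_close_upto[OF A]
      computable_in_compose[OF f] assms(3-) assms(3-)[THEN computable_in_compose])

lemma decidable_in_modulus_guess:
  assumes A: "infinite_join A \<le>\<^sub>T X" and f: "computable_in X f" and h: "computable_in X h"
    and "computable_in X a" "computable_in X b" "computable_in X c"
  shows "decidable_in X (\<lambda>z. modulus_guess A f h (a z) (b z) (c z))"
  unfolding modulus_guess_def
  by (intro computable_in_intros decidable_in_close_guess[OF A f]
      computable_in_compose[OF h] assms(4-) assms(4-)[THEN computable_in_compose])

lemma eventually_close_guess:
  assumes "\<forall>\<^sub>F s in sequentially. close_upto A k m n s"
  shows "\<forall>\<^sub>F u in sequentially. close_guess A f k m n u"
  using assms unfolding eventually_sequentially close_guess_def by (meson le_trans)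

text \<open>If closeness fails infinitely often, its least failure from \<open>u\<close> on is a
  total function of \<open>u\<close> computable from the join. Wherever \<open>f\<close> bounds it,
  the window of \<open>u\<close> contains a failure.\<close>

lemma eventually_not_close_guess:
  assumes f: "\<And>g. computable_in (infinite_join A) g \<Longrightarrow> dominates f g"
    and far: "\<not> (\<forall>\<^sub>F s in sequentially. close_upto A k m n s)"
  shows "\<forall>\<^sub>F u in sequentially. \<not> close_guess A f k m n u"
proof -
  have ex: "\<exists>s. u \<le> s \<and> \<not> close_upto A k m n s" for u
    using far unfolding eventually_sequentially by blast
  have refl: "infinite_join A \<le>\<^sub>T infinite_join A"
    unfolding turing_le_iff by (intro decidable_in_oracle computable_in_id)
  have "computable_in (infinite_join A) (\<lambda>u. LEAST s. u \<le> s \<and> \<not> close_upto A k m n s)"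
    by (intro computable_in_Least ex computable_in_intros decidable_in_close_upto[OF refl])
  from f[OF this] show ?thesis
    unfolding dominates_def
  proof eventually_elim
    case (elim u)
    with LeastI_ex[OF ex[of u]] show ?case unfolding close_guess_def by blast
  qed
qed

text \<open>If closeness to some \<open>n > m\<close> fails infinitely often, its guesses are
  finally all negative, and a late search for a positive one fails. Otherwise positive guesses exist
  beyond every \<open>u\<close> for all relevant \<open>n\<close>, and the least stage by which all
  of them appear is computable in \<open>X\<close>, hence dominated by \<open>h\<close>.\<close>

lemma eventually_modulus_guess_iff:
  assumes f: "\<And>g. computable_in (infinite_join A) g \<Longrightarrow> dominates f g"
    and AX: "infinite_join A \<le>\<^sub>T X" and fX: "computable_in X f"
    and h: "\<And>g. computable_in X g \<Longrightarrow> dominates h g"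
  shows "(\<forall>\<^sub>F u in sequentially. modulus_guess A f h k m u) \<longleftrightarrow>
    (\<forall>n>m. \<forall>\<^sub>F s in sequentially. close_upto A k m n s)"
proof
  assume guess: "\<forall>\<^sub>F u in sequentially. modulus_guess A f h k m u"
  show "\<forall>n>m. \<forall>\<^sub>F s in sequentially. close_upto A k m n s"
  proof (intro allI impI, rule ccontr)
    fix n assume n: "m < n" "\<not> (\<forall>\<^sub>F s in sequentially. close_upto A k m n s)"
    from eventually_not_close_guess[OF f n(2)] obtain b
      where b: "\<And>u. u \<ge> b \<Longrightarrow> \<not> close_guess A f k m n u"
      unfolding eventually_sequentially by blast
    have "\<forall>\<^sub>F u in sequentially. False"
      using guess eventually_ge_at_top[of n] eventually_ge_at_top[of b]
    proof eventually_elim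
      case (elim u)
      then obtain v where "u \<le> v" "close_guess A f k m n v"
        using n(1) unfolding modulus_guess_def by blast
      with b[of v] elim show ?case by simp
    qed
    then show False by simp
  qed
next
  assume near: "\<forall>n>m. \<forall>\<^sub>F s in sequentially. close_upto A k m n s"
  have ex: "\<exists>b. \<forall>n\<le>u. m < n \<longrightarrow> (\<exists>v\<le>b. u \<le> v \<and> close_guess A f k m n v)" for u
  proof -
    have "\<exists>v. u \<le> v \<and> close_guess A f k m n v" if "m < n" for n
      using eventually_close_guess[of A k m n f] near that
      unfolding eventually_sequentially by (meson nle_le)
    then obtain v where v: "\<And>n. m < n \<Longrightarrow> u \<le> v n \<and> close_guess A f k m n (v n)" by metis
    have "v n \<le> Max (v ` {..u})" if "n \<le> u" for n
      using that by (intro Max_ge) auto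
    with v show ?thesis by blast
  qed
  have "computable_in X (\<lambda>u. LEAST b. \<forall>n\<le>u. m < n \<longrightarrow> (\<exists>v\<le>b. u \<le> v \<and> close_guess A f k m n v))"
    by (intro computable_in_Least ex computable_in_intros decidable_in_close_guess[OF AX fX])
  from h[OF this] show "\<forall>\<^sub>F u in sequentially. modulus_guess A f h k m u"
    unfolding dominates_def
  proof eventually_elim
    case (elim u)
    with LeastI_ex[OF ex[of u]] show ?case
      unfolding modulus_guess_def by (meson le_trans)
  qed
qed

text \<open>Each of the finitely many smaller candidates is refuted by some \<open>u\<close>; once
  \<open>p\<close> passes these refutations the bounded search is correct.\<close>

lemma eventually_Least_eq:
  fixes Q :: "nat \<Rightarrow> nat \<Rightarrow> bool"
  assumes "\<exists>v. \<forall>u. Q v u"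
  shows "\<forall>\<^sub>F p in sequentially. (LEAST v. \<forall>u\<le>p. Q v u) = (LEAST v. \<forall>u. Q v u)"
proof -
  define w where "w = (LEAST v. \<forall>u. Q v u)"
  have w: "\<forall>u. Q w u" unfolding w_def using assms by (rule LeastI_ex)
  have "\<exists>u. \<not> Q v u" if "v < w" for v
    using not_less_Least[OF that[unfolded w_def]] by blast
  then obtain b where b: "\<And>v. v < w \<Longrightarrow> \<not> Q v (b v)" by metis
  have "\<forall>\<^sub>F p in sequentially. \<forall>v\<in>{..<w}. b v \<le> p"
    by (intro eventually_ball_finite ballI eventually_ge_at_top) simp
  then have "\<forall>\<^sub>F p in sequentially. (LEAST v. \<forall>u\<le>p. Q v u) = w"
  proof eventually_elim
    case (elim p)
    show ?case
    proof (rule Least_equality)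
      show "\<forall>u\<le>p. Q w u" using w by blast
      show "w \<le> v" if "\<forall>u\<le>p. Q v u" for v
        using that b elim by (meson lessThan_iff not_le)
    qed
  qed
  then show ?thesis unfolding w_def .
qed

lemma limit_computable_modulus:
  assumes f: "\<And>g. computable_in (infinite_join A) g \<Longrightarrow> dominates f g"
    and AX: "infinite_join A \<le>\<^sub>T X" and fX: "computable_in X f"
    and h: "\<And>g. computable_in X g \<Longrightarrow> dominates h g"
    and XZ: "X \<le>\<^sub>T Z" and hZ: "computable_in Z h"
    and cauchy: "delta_cauchy A"
  obtains \<mu> m where "\<And>a b. computable_in Z a \<Longrightarrow> computable_in Z b \<Longrightarrow>
      computable_in Z (\<lambda>z. \<mu> (a z) (b z) :: nat)"
    and "\<And>k. \<forall>\<^sub>F p in sequentially. \<mu> k p = m k"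
    and "\<And>k n. n > m k \<Longrightarrow> \<forall>\<^sub>F s in sequentially. close_upto A k (m k) n s"
proof -
  \<comment> \<open>\<open>v\<close> codes a candidate modulus together with a stage from which its
    guess should hold for good. This turns "eventually" into a universal condition, whose least
    witness is a limit of bounded searches.\<close>
  define Q where "Q = (\<lambda>k v u. snd (prod_decode v) \<le> u \<longrightarrow>
      modulus_guess A f h k (fst (prod_decode v)) u)"
  define \<mu> where "\<mu> = (\<lambda>k p. fst (prod_decode (LEAST v. \<forall>u\<le>p. Q k v u)))"
  define m where "m = (\<lambda>k. fst (prod_decode (LEAST v. \<forall>u. Q k v u)))"
  have iff: "(\<forall>\<^sub>F u in sequentially. modulus_guess A f h k n u) \<longleftrightarrow>
      (\<forall>i>n. \<forall>\<^sub>F s in sequentially. close_upto A k n i s)" for k n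
    using f AX fX h by (rule eventually_modulus_guess_iff)
  have AZ: "infinite_join A \<le>\<^sub>T Z"
    using decidable_in_mono[OF AX[unfolded turing_le_iff] XZ] unfolding turing_le_iff .
  have fZ: "computable_in Z f" using fX XZ by (rule computable_in_mono)
  \<comment> \<open>A candidate with starting stage \<open>p + 1\<close> holds vacuously, so the
    search ends at every \<open>p\<close>.\<close>
  have ex: "\<exists>v. \<forall>u\<le>p. Q k v u" for k p
    by (rule exI[of _ "prod_encode (0, Suc p)"]) (simp add: Q_def)
  have computable: "computable_in Z (\<lambda>z. \<mu> (a z) (b z))"
    if "computable_in Z a" "computable_in Z b" for a b
    unfolding \<mu>_def Q_def
    by (intro computable_in_fst computable_in_Least ex[unfolded Q_def] computable_in_intros
        decidable_in_modulus_guess[OF AZ fZ hZ] that that[THEN computable_in_compose])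
  have stable: "\<exists>v. \<forall>u. Q k v u" for k
  proof -
    obtain n where "\<And>i. i > n \<Longrightarrow> delta (A n) (A i) \<le> ereal (1 / 2 ^ k)"
      using cauchy unfolding delta_cauchy_def by blast
    then have "\<forall>i>n. \<forall>\<^sub>F s in sequentially. close_upto A k n i s"
      using eventually_diff_count_le unfolding close_upto_def by blast
    then have "\<forall>\<^sub>F u in sequentially. modulus_guess A f h k n u" by (rule iffD2[OF iff])
    then obtain b where "\<forall>u\<ge>b. modulus_guess A f h k n u"
      unfolding eventually_sequentially ..
    then have "\<forall>u. Q k (prod_encode (n, b)) u" by (simp add: Q_def)
    then show ?thesis ..
  qed
  have limit: "\<forall>\<^sub>F p in sequentially. \<mu> k p = m k" for k
    using eventually_Least_eq[OF stable[of k]] unfolding \<mu>_def m_def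
    by eventually_elim (rule arg_cong)
  have "\<forall>\<^sub>F u in sequentially. modulus_guess A f h k (m k) u" for k
  proof -
    define v where "v = (LEAST v. \<forall>u. Q k v u)"
    have Q: "\<forall>u. Q k v u" unfolding v_def using stable by (rule LeastI_ex)
    have m: "m k = fst (prod_decode v)" by (simp add: m_def v_def)
    have "modulus_guess A f h k (m k) u" if "u \<ge> snd (prod_decode v)" for u
      using spec[OF Q, of u] that unfolding m by (simp add: Q_def)
    then show ?thesis unfolding eventually_sequentially by blast
  qed
  then have "\<forall>\<^sub>F s in sequentially. close_upto A k (m k) n s" if "n > m k" for k n
    using iffD1[OF iff] that by blast
  with computable limit show ?thesis by (rule that)
qed

section \<open>Gluing the sets along powers of two\<close>

lemma diff_count_mono: "m \<le> n \<Longrightarrow> diff_count X Y m \<le> diff_count X Y n"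
  unfolding diff_count_def by (rule card_mono) auto

lemma diff_count_le: "diff_count X Y n \<le> n"
  using card_mono[of "{0..<n}" "sym_diff X Y \<inter> {0..<n}"] by (simp add: diff_count_def)

text \<open>On the block \<open>[2 ^ (t - 1), 2 ^ t)\<close> the glued set copies \<open>A (j (2 ^ t))\<close>.\<close>

definition glue :: "(nat \<Rightarrow> nat set) \<Rightarrow> (nat \<Rightarrow> nat) \<Rightarrow> nat set" where
  "glue A j = {x. x \<in> A (j (2 ^ (LEAST t. x < 2 ^ t)))}"

text \<open>The errors of the blocks form a geometric series, which doubles the error of the last
  block; passing from a power of two to arbitrary \<open>n\<close> costs another factor 2. The
  constant pays for the segment below \<open>2 ^ b\<close>, where the hypothesis may fail.\<close>

lemma diff_count_glue:
  assumes "\<forall>\<^sub>F p in sequentially. diff_count B (A (j p)) p * 2 ^ k \<le> 2 * p"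
  obtains c where "\<And>n. diff_count B (glue A j) n * 2 ^ k \<le> 8 * n + c"
proof -
  obtain b where b: "\<And>p. p \<ge> b \<Longrightarrow> diff_count B (A (j p)) p * 2 ^ k \<le> 2 * p"
    using assms unfolding eventually_sequentially by blast
  let ?L = "glue A j"
  have pow: "diff_count B ?L (2 ^ t) * 2 ^ k \<le> 4 * 2 ^ t + 2 ^ b * 2 ^ k" for t
  proof (induction t)
    case 0
    have "diff_count B ?L (2 ^ 0) * 2 ^ k \<le> 2 ^ b * 2 ^ k"
      using diff_count_le[of B ?L 1] by (intro mult_le_mono1) (simp add: order_trans)
    then show ?case by linarith
  next
    case (Suc t)
    show ?case
    proof (cases "b \<le> t")
      case True
      let ?p = "2 ^ Suc t"
      have L: "x \<in> ?L \<longleftrightarrow> x \<in> A (j ?p)" if "2 ^ t \<le> x" "x < ?p" for x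
      proof -
        have "(LEAST t. x < 2 ^ t) = Suc t"
        proof (rule Least_equality)
          show "Suc t \<le> i" if "x < 2 ^ i" for i
          proof -
            have "(2 :: nat) ^ t < 2 ^ i" using \<open>2 ^ t \<le> x\<close> that by (rule order_le_less_trans)
            then show ?thesis by simp
          qed
        qed (rule that(2))
        then show ?thesis by (simp add: glue_def)
      qed
      have "diff_count B ?L ?p \<le> card ((sym_diff B ?L \<inter> {0..<2 ^ t}) \<union>
          (sym_diff B (A (j ?p)) \<inter> {0..<?p}))"
        unfolding diff_count_def
      proof (rule card_mono)
        show "sym_diff B ?L \<inter> {0..<?p} \<subseteq> (sym_diff B ?L \<inter> {0..<2 ^ t}) \<union>
            (sym_diff B (A (j ?p)) \<inter> {0..<?p})"
        proof
          fix x assume x: "x \<in> sym_diff B ?L \<inter> {0..<?p}"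
          show "x \<in> (sym_diff B ?L \<inter> {0..<2 ^ t}) \<union> (sym_diff B (A (j ?p)) \<inter> {0..<?p})"
          proof (cases "x < 2 ^ t")
            case False
            with x L[of x] show ?thesis by (simp del: power_Suc)
          qed (use x in simp)
        qed
      qed simp
      also have "\<dots> \<le> diff_count B ?L (2 ^ t) + diff_count B (A (j ?p)) ?p"
        unfolding diff_count_def by (rule card_Un_le)
      finally have "diff_count B ?L ?p * 2 ^ k \<le>
          (diff_count B ?L (2 ^ t) + diff_count B (A (j ?p)) ?p) * 2 ^ k"
        by (rule mult_le_mono1)
      moreover have "b \<le> ?p" using True less_exp[of "Suc t"] by linarith
      then have "diff_count B (A (j ?p)) ?p * 2 ^ k \<le> 2 * ?p" by (rule b)
      ultimately show ?thesis using Suc.IH by (simp add: add_mult_distrib)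
    next
      case False
      then have "(2 :: nat) ^ Suc t \<le> 2 ^ b" by (intro power_increasing) auto
      then have "diff_count B ?L (2 ^ Suc t) * 2 ^ k \<le> 2 ^ b * 2 ^ k"
        by (intro mult_le_mono1 order_trans[OF diff_count_le])
      then show ?thesis by linarith
    qed
  qed
  have "diff_count B ?L n * 2 ^ k \<le> 8 * n + 2 ^ b * 2 ^ k" for n
  proof (cases "n = 0")
    case False
    then obtain t where t: "2 ^ t \<le> n" "n < 2 ^ Suc t"
      using ex_power_ivl1[of 2 n] by auto
    have "diff_count B ?L n * 2 ^ k \<le> diff_count B ?L (2 ^ Suc t) * 2 ^ k"
      using t(2) by (intro mult_le_mono1 diff_count_mono) simp
    also have "\<dots> \<le> 4 * 2 ^ Suc t + 2 ^ b * 2 ^ k" by (rule pow)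
    finally show ?thesis using t(1) by simp
  qed (simp add: diff_count_def)
  then show ?thesis by (rule that)
qed

lemma limit_of_modulus:
  assumes AZ: "infinite_join A \<le>\<^sub>T Z"
    and computable: "\<And>a b. computable_in Z a \<Longrightarrow> computable_in Z b \<Longrightarrow>
      computable_in Z (\<lambda>z. \<mu> (a z) (b z))"
    and limit: "\<And>k. \<forall>\<^sub>F p in sequentially. \<mu> k p = m k"
    and near: "\<And>k n. n > m k \<Longrightarrow> \<forall>\<^sub>F s in sequentially. close_upto A k (m k) n s"
  obtains L where "L \<le>\<^sub>T Z" "delta_limit A L"
proof -
  \<comment> \<open>Coherence compares the guesses for \<open>k + 1\<close> and \<open>i + 1\<close>
    only to precision \<open>k\<close>: a comparison of true moduli passes through a third set and
    loses a factor 2.\<close>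
  define ok where "ok = (\<lambda>i p. \<forall>k\<le>i. close_upto A k (\<mu> (Suc k) p) (\<mu> (Suc i) p) p)"
  \<comment> \<open>The largest coherent \<open>i \<le> p\<close> is reached by searching downwards
    from \<open>p\<close>; \<open>i = 0\<close> always qualifies, since a set is compared with
    itself.\<close>
  define j where "j = (\<lambda>p. \<mu> (Suc (p - (LEAST d. ok (p - d) p))) p)"
  have ex: "\<exists>d. ok (p - d) p" for p
    by (rule exI[of _ p]) (simp add: ok_def close_upto_def)
  have "computable_in Z (\<lambda>p. LEAST d. ok (p - d) p)"
    unfolding ok_def
    by (intro computable_in_Least ex[unfolded ok_def] computable_in_intros
        decidable_in_close_upto[OF AZ] computable)
  then have j_computable: "computable_in Z j"
    unfolding j_def by (intro computable computable_in_intros)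
  have mm: "\<forall>\<^sub>F p in sequentially. close_upto A k (m (Suc k)) (m (Suc i)) p" if "k \<le> i" for k i
  proof -
    \<comment> \<open>Closeness is known only to sets beyond the modulus, so both moduli are
      compared with a common later \<open>n\<close>.\<close>
    define n where "n = Suc (max (m (Suc k)) (m (Suc i)))"
    have "n > m (Suc k)" "n > m (Suc i)" by (auto simp: n_def)
    from near[OF this(1)] near[OF this(2)] show ?thesis
    proof eventually_elim
      case (elim p)
      let ?c = "diff_count (A (m (Suc k))) (A n) p" and ?d = "diff_count (A n) (A (m (Suc i))) p"
      have "?c * 2 ^ Suc k \<le> 2 * p" using elim(1) by (simp add: close_upto_def)
      moreover have "?d * 2 ^ Suc k \<le> 2 * p"
      proof -
        have "?d * 2 ^ Suc k \<le> ?d * 2 ^ Suc i"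
          using that by (intro mult_le_mono2 power_increasing) auto
        also have "\<dots> \<le> 2 * p"
          using elim(2) unfolding close_upto_def diff_count_commute[of "A n"] .
        finally show ?thesis .
      qed
      moreover have "diff_count (A (m (Suc k))) (A (m (Suc i))) p * 2 ^ k \<le> (?c + ?d) * 2 ^ k"
        by (intro mult_le_mono1 diff_count_triangle)
      ultimately show ?case by (simp add: close_upto_def add_mult_distrib)
    qed
  qed
  have ok: "\<forall>\<^sub>F p in sequentially. ok i p" for i
  proof -
    have "\<forall>\<^sub>F p in sequentially. \<forall>k\<in>{..i}. close_upto A k (\<mu> (Suc k) p) (\<mu> (Suc i) p) p"
    proof (intro eventually_ball_finite ballI)
      fix k assume "k \<in> {..i}"
      then have "k \<le> i" by simp
      from mm[OF this] limit[of "Suc k"] limit[of "Suc i"]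
      show "\<forall>\<^sub>F p in sequentially. close_upto A k (\<mu> (Suc k) p) (\<mu> (Suc i) p) p"
        by eventually_elim simp
    qed simp
    then show ?thesis by eventually_elim (simp add: ok_def)
  qed
  \<comment> \<open>The selected guess may itself be wrong. For large \<open>p\<close> its index is
    at least \<open>k\<close>, and its coherence with the settled guess for \<open>k + 1\<close>
    suffices.\<close>
  have j: "\<forall>\<^sub>F p in sequentially. close_upto A k (m (Suc k)) (j p) p" for k
    using ok[of k] eventually_ge_at_top[of k] limit[of "Suc k"]
  proof eventually_elim
    case (elim p)
    define d where "d = (LEAST d. ok (p - d) p)"
    have "ok (p - d) p" unfolding d_def using ex by (rule LeastI_ex)
    moreover have "d \<le> p - k" unfolding d_def using elim(1,2) by (intro Least_le) simp
    then have "k \<le> p - d" using elim(2) by linarith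
    ultimately have "close_upto A k (\<mu> (Suc k) p) (\<mu> (Suc (p - d)) p) p"
      unfolding ok_def by blast
    moreover have "j p = \<mu> (Suc (p - d)) p" by (simp add: j_def d_def)
    ultimately show ?case using elim(3) by simp
  qed
  \<comment> \<open>With moduli at \<open>k + 5\<close>, the two errors are at most
    \<open>2 * p / 2 ^ (k + 5)\<close> and \<open>2 * p / 2 ^ (k + 4)\<close>, together below
    \<open>2 * p / 2 ^ (k + 3)\<close>. The spare factor \<open>2 ^ 3\<close> absorbs the 8 of
    \<open>diff_count_glue\<close>.\<close>
  have "delta (A n) (glue A j) \<le> ereal (1 / 2 ^ k)" if n: "n > m (k + 5)" for n k
  proof -
    have Suc4: "Suc (k + 4) = k + 5" by simp
    have "\<forall>\<^sub>F p in sequentially. diff_count (A n) (A (j p)) p * 2 ^ (k + 3) \<le> 2 * p"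
      using near[OF n] j[of "k + 4", unfolded Suc4]
    proof eventually_elim
      case (elim p)
      let ?c = "diff_count (A n) (A (m (k + 5))) p" and ?d = "diff_count (A (m (k + 5))) (A (j p)) p"
      have "32 * (?c * 2 ^ k) \<le> 2 * p"
        using elim(1) by (simp add: close_upto_def diff_count_commute[of "A n"] power_add)
      moreover have "16 * (?d * 2 ^ k) \<le> 2 * p"
        using elim(2) by (simp add: close_upto_def power_add)
      moreover have "diff_count (A n) (A (j p)) p * 2 ^ k \<le> ?c * 2 ^ k + ?d * 2 ^ k"
        unfolding add_mult_distrib[symmetric] by (intro mult_le_mono1 diff_count_triangle)
      moreover have "diff_count (A n) (A (j p)) p * 2 ^ (k + 3)
          = 8 * (diff_count (A n) (A (j p)) p * 2 ^ k)"
        by (simp add: power_add)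
      ultimately show ?case by linarith
    qed
    then obtain c where c: "\<And>s. diff_count (A n) (glue A j) s * 2 ^ (k + 3) \<le> 8 * s + c"
      by (rule diff_count_glue) blast
    show ?thesis
    proof (rule delta_leI)
      show "diff_count (A n) (glue A j) s * 2 ^ k \<le> s + c" for s
        using c[of s] by (simp add: power_add)
    qed
  qed
  then have "delta_limit A (glue A j)" unfolding delta_limit_def by blast
  moreover have "glue A j \<le>\<^sub>T Z"
  proof -
    have "\<exists>t. x < 2 ^ t" for x :: nat using less_exp by blast
    then show ?thesis unfolding turing_le_iff glue_def mem_Collect_eq
      by (intro decidable_in_infinite_join[OF AZ] computable_in_compose[OF j_computable]
          computable_in_Least computable_in_intros)
  qed
  ultimately show ?thesis using that by blast
qed

lemma DOM_imp_delta_complete: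
  assumes M: "turing_ideal M" and dom: "DOM M"
  shows "delta_complete M"
  unfolding delta_complete_def
proof (intro allI impI, elim conjE)
  fix A assume A: "delta_cauchy A" "infinite_join A \<in> M"
  obtain f where f: "graph_of f \<in> M" "\<And>g. computable_in (infinite_join A) g \<Longrightarrow> dominates f g"
    using dom A(2) unfolding DOM_def by blast
  define X where "X = turing_join (infinite_join A) (graph_of f)"
  have X: "X \<in> M" unfolding X_def using M A(2) f(1) by (rule turing_ideal_join)
  \<comment> \<open>The second use of \<open>DOM\<close> is relative to \<open>X\<close>, which
    computes \<open>f\<close>, because \<open>close_guess\<close> is decided with the help of
    \<open>f\<close>.\<close>
  obtain h where h: "graph_of h \<in> M" "\<And>g. computable_in X g \<Longrightarrow> dominates h g"
    using dom X unfolding DOM_def by blast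
  define Z where "Z = turing_join X (graph_of h)"
  have Z: "Z \<in> M" unfolding Z_def using M X h(1) by (rule turing_ideal_join)
  have AX: "infinite_join A \<le>\<^sub>T X" unfolding X_def by (rule turing_le_join1)
  have XZ: "X \<le>\<^sub>T Z" unfolding Z_def by (rule turing_le_join1)
  have AZ: "infinite_join A \<le>\<^sub>T Z"
    using decidable_in_mono[OF AX[unfolded turing_le_iff] XZ] unfolding turing_le_iff .
  have fX: "computable_in X f"
    unfolding X_def by (rule computable_in_mono[OF computable_in_graph turing_le_join2])
  have hZ: "computable_in Z h"
    unfolding Z_def by (rule computable_in_mono[OF computable_in_graph turing_le_join2])
  obtain \<mu> m where \<mu>: "\<And>a b. computable_in Z a \<Longrightarrow> computable_in Z b \<Longrightarrow>
      computable_in Z (\<lambda>z. \<mu> (a z) (b z) :: nat)"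
    "\<And>k. \<forall>\<^sub>F p in sequentially. \<mu> k p = m k"
    "\<And>k n. n > m k \<Longrightarrow> \<forall>\<^sub>F s in sequentially. close_upto A k (m k) n s"
    using limit_computable_modulus[OF f(2) AX fX h(2) XZ hZ A(1)] by blast
  obtain L where L: "L \<le>\<^sub>T Z" "delta_limit A L"
    using limit_of_modulus[OF AZ \<mu>] by blast
  show "\<exists>L\<in>M. delta_limit A L" using turing_ideal_down[OF M L(1) Z] L(2) by blast
qed

theorem theorem8p7:
  "omega_equivalent delta_complete DOM"
  unfolding omega_equivalent_def
  using delta_complete_imp_DOM DOM_imp_delta_complete by blast

end
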